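(* Consider the kernel operator $\mathcal K:\mathcal U\to\mathcal X_K$, $\mathcal K(l):=K(\xi,\eta,t)$, where $K$ is the unique solution of the kernel equation associated with $l$ (all as defined in the context). Then, for any given $T>t_0$, the operator satisfies $$\mathcal K\in C\bigl(\mathcal U,\;C(\bar S\times[t_0,T])\bigr),$$ i.e. $\mathcal K$ is continuous from $\mathcal U$, with the metric induced by the $C^2([t_0,T])$ norm, to $C(\bar S\times[t_0,T])$ with the supremum norm.
   Context: Constants: $t_0\ge 0$, $T>t_0$, $\alpha>0$, $\lambda_0>0$, and a real tuning parameter $c$ are fixed. Spatial domain: $\bar S:=\{(\xi,\eta):0\le\eta\le\xi\le 2-\eta\}$. Moving-boundary functions: $\mathcal U$ is a compact subset of the space of real analytic functions $C^\omega([t_0,T])$, consisting of strictly positive functions, equipped with the metric induced by the $C^2([t_0,T])$ norm. Standing assumption on a moving-boundary function $l$: $l$ is analytic and there is a constant $\bar D>0$, independent of $t$ and $j$, such that $|\partial_t^j l(t)|\le \bar D^{j+1}j!$ for all times $t>t_0$ under consideration and all integers $j\ge0$. This is a condition on each function $l$ individually; no constant common to all of $\mathcal U$ is assumed. Kernel equation: for $l\in\mathcal U$ put $$\bar\lambda(\xi,\eta,t)=-\frac{\dot l^2(t)+l(t)\ddot l(t)(\xi-\eta)}{4\alpha}+\lambda_0+c,\qquad f(\xi,t)=\frac{\xi\, l(t)}{4\alpha}\left[\frac{2\dot l^2(t)+\xi\, l(t)\ddot l(t)}{8\alpha}-(\lambda_0+c)\right].$$ The kernel $K$ associated with $l$ is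 the solution, for $(\xi,\eta)\in\bar S$ and $t\in[t_0,T]$, of $$\partial_tK=\frac{4\alpha}{l^2(t)}\partial_\xi\partial_\eta K+\frac{\dot l(t)}{l(t)}\bigl(\xi\partial_\xi K+\eta\partial_\eta K\bigr)-\bar\lambda(\xi,\eta,t)K,\qquad K(\xi,\xi,t)=0,\qquad K(\xi,0,t)=f(\xi,t).$$ It is taken from the literature that this problem has a unique solution $K\in C^2(\bar S\times[t_0,T])$, and that there is a constant $M>0$ with $\|K(\cdot,\cdot,t)\|_{L^\infty(\bar S)}+\|\partial_tK(\cdot,\cdot,t)\|_{L^\infty(\bar S)}\le M$ for all $t\in[t_0,T]$. Target space: $\mathcal X_K=\{K\in C(\bar S\times[t_0,T]): K(\xi,\xi,t)=0 \text{ for all points } (\xi,\xi)\in\bar S \text{ and all } t\in[t_0,T]\}$.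
   Formalization: The constant M bounding the kernel and its time derivative is assumed common to all l in U; if M may depend on l the claim fails, e.g. for U = {1} together with l_n = 1 + w_n^(-5) cos(w_n t), c = -lambda_0. *)

theory Defs
  imports "HOL-Analysis.Analysis"
begin

section \<open>Real analytic functions on a compact interval, with the \<open>C\<^sup>2\<close> metric\<close>

text \<open>Derivatives with respect to time are taken within \<open>{t0..T}\<close>, so they are one-sided at the two
  endpoints and do not depend on values outside the interval.\<close>

primrec tderiv :: "real \<Rightarrow> real \<Rightarrow> nat \<Rightarrow> (real \<Rightarrow> real) \<Rightarrow> real \<Rightarrow> real" where
  "tderiv t0 T 0 l = l"
| "tderiv t0 T (Suc j) l = (\<lambda>t. vector_derivative (tderiv t0 T j l) (at t within {t0..T}))"

definition real_analytic_Icc :: "real \<Rightarrow> real \<Rightarrow> (real \<Rightarrow> real) \<Rightarrow> bool" where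
  "real_analytic_Icc t0 T l \<longleftrightarrow>
     (\<forall>x\<in>{t0..T}. \<exists>r>0. \<exists>a :: nat \<Rightarrow> real.
        \<forall>y\<in>{t0..T}. \<bar>y - x\<bar> < r \<longrightarrow> (\<lambda>n. a n * (y - x) ^ n) sums l y)"

text \<open>Membership in \<^const>\<open>extensional\<close> fixes the value outside \<open>{t0..T}\<close>, so that equality
  of functions is equality on the interval.\<close>

definition Comega :: "real \<Rightarrow> real \<Rightarrow> (real \<Rightarrow> real) set" where
  "Comega t0 T = {l \<in> extensional {t0..T}. real_analytic_Icc t0 T l}"

text \<open>The value \<open>0\<close> off the carrier is never used; it is there because \<^locale>\<open>Metric_space\<close>
  requires a distance that is nonnegative on the whole type.\<close>

definition C2_dist :: "real \<Rightarrow> real \<Rightarrow> (real \<Rightarrow> real) \<Rightarrow> (real \<Rightarrow> real) \<Rightarrow> real" where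
  "C2_dist t0 T l m =
     (if l \<in> Comega t0 T \<and> m \<in> Comega t0 T
      then \<Sum>j\<le>2. SUP t\<in>{t0..T}. \<bar>tderiv t0 T j l t - tderiv t0 T j m t\<bar>
      else 0)"

definition Comega_metric :: "real \<Rightarrow> real \<Rightarrow> (real \<Rightarrow> real) metric" where
  "Comega_metric t0 T = metric (Comega t0 T, C2_dist t0 T)"

lemma real_analytic_Icc_local:
  assumes "t0 < T" "real_analytic_Icc t0 T l" "x \<in> {t0..T}"
  obtains r a where "r > 0" "\<And>z. \<bar>z\<bar> < r \<Longrightarrow> summable (\<lambda>n. a n * z ^ n)"
    "\<And>y. y \<in> {t0..T} \<Longrightarrow> \<bar>y - x\<bar> < r \<Longrightarrow> l y = (\<Sum>n. a n * (y - x) ^ n)"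
proof -
  obtain r a where r: "r > 0" and
    a: "\<And>y. y \<in> {t0..T} \<Longrightarrow> \<bar>y - x\<bar> < r \<Longrightarrow> (\<lambda>n. a n * (y - x) ^ n) sums l y"
    using assms unfolding real_analytic_Icc_def by meson
  define s where "s = min r ((T - t0) / 2)"
  have "s > 0" using r assms(1) by (simp add: s_def)
  moreover have "summable (\<lambda>n. a n * z ^ n)" if z: "\<bar>z\<bar> < s" for z
  proof -
    define w where "w = (\<bar>z\<bar> + s) / 2"
    have w: "\<bar>z\<bar> < w" "w < s" "0 < w" using z by (auto simp: w_def)
    have ws: "w < r" "w < (T - t0) / 2" using w by (auto simp: s_def)
    obtain y where y: "y \<in> {t0..T}" "\<bar>y - x\<bar> = w"
    proof (cases "x + w \<le> T")
      case True
      then show ?thesis using that[of "x + w"] w assms(3) by auto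
    next
      case False
      then have "x - w \<ge> t0" using ws by (simp add: field_simps)
      then show ?thesis using that[of "x - w"] w assms(3) by auto
    qed
    have "summable (\<lambda>n. a n * (y - x) ^ n)"
      using a[of y] y ws by (auto simp: sums_iff)
    then show ?thesis by (rule powser_inside) (use y w in auto)
  qed
  moreover have "l y = (\<Sum>n. a n * (y - x) ^ n)" if "y \<in> {t0..T}" "\<bar>y - x\<bar> < s" for y
    using a[of y] that by (auto simp: s_def sums_iff)
  ultimately show ?thesis using that by blast
qed

lemma real_analytic_Icc_derivative:
  assumes "t0 < T" "real_analytic_Icc t0 T l"
  shows "\<And>y. y \<in> {t0..T} \<Longrightarrow>
      (l has_vector_derivative vector_derivative l (at y within {t0..T})) (at y within {t0..T})"
    and "real_analytic_Icc t0 T (\<lambda>t. vector_derivative l (at t within {t0..T}))"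
proof -
  have main: "\<exists>r>0. \<exists>a :: nat \<Rightarrow> real. \<forall>y\<in>{t0..T}. \<bar>y - x\<bar> < r \<longrightarrow>
      (l has_vector_derivative vector_derivative l (at y within {t0..T})) (at y within {t0..T}) \<and>
      (\<lambda>n. a n * (y - x) ^ n) sums vector_derivative l (at y within {t0..T})"
    if x: "x \<in> {t0..T}" for x
  proof -
    obtain r a where r: "r > 0" and
      sm: "\<And>z. \<bar>z\<bar> < r \<Longrightarrow> summable (\<lambda>n. a n * z ^ n)" and
      eq: "\<And>y. y \<in> {t0..T} \<Longrightarrow> \<bar>y - x\<bar> < r \<Longrightarrow> l y = (\<Sum>n. a n * (y - x) ^ n)"
      using real_analytic_Icc_local[OF assms x] by metis
    have "(l has_vector_derivative vector_derivative l (at y within {t0..T})) (at y within {t0..T}) \<and>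
      (\<lambda>n. diffs a n * (y - x) ^ n) sums vector_derivative l (at y within {t0..T})"
      if y: "y \<in> {t0..T}" "\<bar>y - x\<bar> < r" for y
    proof -
      let ?D = "\<Sum>n. diffs a n * (y - x) ^ n"
      have "((\<lambda>z. \<Sum>n. a n * z ^ n) has_field_derivative ?D) (at (y - x))"
        by (rule termdiffs_strong'[of r]) (use sm y in auto)
      then have "((\<lambda>s. \<Sum>n. a n * (s - x) ^ n) has_field_derivative ?D) (at y)"
        using DERIV_shift[of "\<lambda>z. \<Sum>n. a n * z ^ n" ?D y "- x"] by simp
      then have "((\<lambda>s. \<Sum>n. a n * (s - x) ^ n) has_field_derivative ?D) (at y within {t0..T})"
        by (rule has_field_derivative_at_within)
      then have "(l has_field_derivative ?D) (at y within {t0..T})"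
        by (rule has_field_derivative_transform_within[where d = "r - \<bar>y - x\<bar>"])
           (use y in \<open>auto simp: dist_real_def intro!: eq[symmetric]\<close>)
      then have D: "(l has_vector_derivative ?D) (at y within {t0..T})"
        by (simp add: has_real_derivative_iff_has_vector_derivative)
      then have "vector_derivative l (at y within {t0..T}) = ?D"
        by (rule vector_derivative_within_closed_interval[OF assms(1) y(1)])
      moreover have "summable (\<lambda>n. diffs a n * (y - x) ^ n)"
        by (rule termdiff_converges[of _ r]) (use sm y in auto)
      ultimately show ?thesis using D by (simp add: summable_sums)
    qed
    then show ?thesis using r by blast
  qed
  show "(l has_vector_derivative vector_derivative l (at y within {t0..T})) (at y within {t0..T})"
    if "y \<in> {t0..T}" for y
    using main[OF that] that by force
  show "real_analytic_Icc t0 T (\<lambda>t. vector_derivative l (at t within {t0..T}))"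
    unfolding real_analytic_Icc_def using main by meson
qed

lemma real_analytic_Icc_tderiv:
  assumes "t0 < T" "real_analytic_Icc t0 T l"
  shows "real_analytic_Icc t0 T (tderiv t0 T j l)"
  by (induction j) (use assms real_analytic_Icc_derivative(2) in auto)

lemma continuous_on_tderiv:
  assumes "t0 < T" "real_analytic_Icc t0 T l"
  shows "continuous_on {t0..T} (tderiv t0 T j l)"
  using real_analytic_Icc_derivative(1)[OF assms(1) real_analytic_Icc_tderiv[OF assms]]
  by (intro continuous_on_vector_derivative)

lemma Metric_space_Comega:
  assumes "t0 < T"
  shows "Metric_space (Comega t0 T) (C2_dist t0 T)"
proof -
  let ?I = "{t0..T}"
  let ?s = "\<lambda>j l m. SUP t\<in>?I. \<bar>tderiv t0 T j l t - tderiv t0 T j m t\<bar>"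
  have bdd: "bdd_above ((\<lambda>t. \<bar>tderiv t0 T j l t - tderiv t0 T j m t\<bar>) ` ?I)"
    if "l \<in> Comega t0 T" "m \<in> Comega t0 T" for j l m
    using that assms
    by (intro compact_imp_bounded[THEN bounded_imp_bdd_above] compact_continuous_image
        continuous_intros continuous_on_tderiv) (auto simp: Comega_def)
  have le: "\<bar>tderiv t0 T j l t - tderiv t0 T j m t\<bar> \<le> ?s j l m"
    if "l \<in> Comega t0 T" "m \<in> Comega t0 T" "t \<in> ?I" for j l m t
    using bdd[OF that(1,2)] that(3) by (rule cSUP_upper2) auto
  have nn: "0 \<le> ?s j l m" if "l \<in> Comega t0 T" "m \<in> Comega t0 T" for j l m
    using le[OF that, of t0 j] assms by fastforce
  have tri: "?s j l n \<le> ?s j l m + ?s j m n"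
    if "l \<in> Comega t0 T" "m \<in> Comega t0 T" "n \<in> Comega t0 T" for j l m n
  proof (rule cSUP_least)
    fix t assume "t \<in> ?I"
    then show "\<bar>tderiv t0 T j l t - tderiv t0 T j n t\<bar> \<le> ?s j l m + ?s j m n"
      using le[of l m t j] le[of m n t j] that by linarith
  qed (use assms in auto)
  define d where "d = C2_dist t0 T"
  have d: "d l m = (\<Sum>j\<le>2. ?s j l m)" if "l \<in> Comega t0 T" "m \<in> Comega t0 T" for l m
    using that by (simp add: d_def C2_dist_def)
  have "0 \<le> d l m" for l m
    using nn[of l m] by (auto simp: d_def C2_dist_def intro!: sum_nonneg)
  moreover have "d l m = d m l" for l m
    by (simp add: d_def C2_dist_def abs_minus_commute)
  moreover have "d l m = 0 \<longleftrightarrow> l = m" if lm: "l \<in> Comega t0 T" "m \<in> Comega t0 T" for l m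
  proof
    assume "d l m = 0"
    then have "(\<Sum>j\<le>2. ?s j l m) = 0" using d[OF lm] by simp
    then have "\<forall>j\<in>{..2}. ?s j l m = 0"
      by (subst (asm) sum_nonneg_eq_0_iff) (use nn[OF lm] in auto)
    then have *: "?s 0 l m = 0" by blast
    show "l = m"
    proof (rule extensionalityI)
      show "l \<in> extensional ?I" "m \<in> extensional ?I" using lm by (auto simp: Comega_def)
      show "l t = m t" if "t \<in> ?I" for t
        using le[OF lm that, of 0] * by simp
    qed
  next
    assume "l = m"
    then show "d l m = 0" using assms by (simp add: d_def C2_dist_def)
  qed
  moreover have "d l n \<le> d l m + d m n"
    if "l \<in> Comega t0 T" "m \<in> Comega t0 T" "n \<in> Comega t0 T" for l m n
    using that by (simp add: d sum.distrib[symmetric] sum_mono tri del: sum.atMost_Suc)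
  ultimately have "Metric_space (Comega t0 T) d"
    unfolding Metric_space_def by blast
  then show ?thesis by (simp add: d_def)
qed

lemma mspace_Comega_metric [simp]: "t0 < T \<Longrightarrow> mspace (Comega_metric t0 T) = Comega t0 T"
  and mdist_Comega_metric [simp]: "t0 < T \<Longrightarrow> mdist (Comega_metric t0 T) = C2_dist t0 T"
  by (simp_all add: Comega_metric_def Metric_space.mspace_metric Metric_space.mdist_metric
      Metric_space_Comega)

definition factorial_derivative_bound :: "real \<Rightarrow> real \<Rightarrow> (real \<Rightarrow> real) \<Rightarrow> bool" where
  "factorial_derivative_bound t0 T l \<longleftrightarrow>
     (\<exists>D>0. \<forall>t\<in>{t0<..T}. \<forall>j. \<bar>tderiv t0 T j l t\<bar> \<le> D ^ (j + 1) * fact j)"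


section \<open>Functions of class \<open>C\<^sup>n\<close> up to the boundary\<close>

text \<open>Partial derivatives are values of the Frechet derivative within the closed domain rather than
  limits along coordinate lines: at the corner \<open>(1, 1)\<close> of the triangle below, the horizontal line
  meets the domain in a single point. On a convex set with nonempty interior the Frechet
  derivative is unique at every point.\<close>

definition pderiv_in ::
    "'a::real_normed_vector set \<Rightarrow> 'a \<Rightarrow> ('a \<Rightarrow> real) \<Rightarrow> 'a \<Rightarrow> real" where
  "pderiv_in X v g x = frechet_derivative g (at x within X) v"

primrec Cn_on :: "nat \<Rightarrow> 'a::euclidean_space set \<Rightarrow> ('a \<Rightarrow> real) \<Rightarrow> bool" where
  "Cn_on 0 X g \<longleftrightarrow> continuous_on X g"
| "Cn_on (Suc n) X g \<longleftrightarrow> g differentiable_on X \<and> (\<forall>v\<in>Basis. Cn_on n X (pderiv_in X v g))"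


section \<open>The kernel equation\<close>

definition Sbar :: "(real \<times> real) set" where
  "Sbar = {(\<xi>, \<eta>). 0 \<le> \<eta> \<and> \<eta> \<le> \<xi> \<and> \<xi> \<le> 2 - \<eta>}"

text \<open>Points are written \<open>((\<xi>, \<eta>), t)\<close>.\<close>

definition Kdom :: "real \<Rightarrow> real \<Rightarrow> ((real \<times> real) \<times> real) set" where
  "Kdom t0 T = Sbar \<times> {t0..T}"

abbreviation d_xi ::
    "real \<Rightarrow> real \<Rightarrow> ((real \<times> real) \<times> real \<Rightarrow> real) \<Rightarrow> (real \<times> real) \<times> real \<Rightarrow> real" where
  "d_xi t0 T \<equiv> pderiv_in (Kdom t0 T) ((1, 0), 0)"

abbreviation d_eta ::
    "real \<Rightarrow> real \<Rightarrow> ((real \<times> real) \<times> real \<Rightarrow> real) \<Rightarrow> (real \<times> real) \<times> real \<Rightarrow> real" where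
  "d_eta t0 T \<equiv> pderiv_in (Kdom t0 T) ((0, 1), 0)"

abbreviation d_t ::
    "real \<Rightarrow> real \<Rightarrow> ((real \<times> real) \<times> real \<Rightarrow> real) \<Rightarrow> (real \<times> real) \<times> real \<Rightarrow> real" where
  "d_t t0 T \<equiv> pderiv_in (Kdom t0 T) ((0, 0), 1)"

definition lambda_bar ::
    "real \<Rightarrow> real \<Rightarrow> real \<Rightarrow> real \<Rightarrow> real \<Rightarrow> (real \<Rightarrow> real) \<Rightarrow> real \<Rightarrow> real \<Rightarrow> real \<Rightarrow> real" where
  "lambda_bar t0 T \<alpha> lam0 c l \<xi> \<eta> t =
     - ((tderiv t0 T 1 l t)\<^sup>2 + l t * tderiv t0 T 2 l t * (\<xi> - \<eta>)) / (4 * \<alpha>) + lam0 + c"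

definition f_bdry ::
    "real \<Rightarrow> real \<Rightarrow> real \<Rightarrow> real \<Rightarrow> real \<Rightarrow> (real \<Rightarrow> real) \<Rightarrow> real \<Rightarrow> real \<Rightarrow> real" where
  "f_bdry t0 T \<alpha> lam0 c l \<xi> t =
     \<xi> * l t / (4 * \<alpha>) *
       ((2 * (tderiv t0 T 1 l t)\<^sup>2 + \<xi> * l t * tderiv t0 T 2 l t) / (8 * \<alpha>) - (lam0 + c))"

text \<open>As for \<^const>\<open>Comega\<close>, membership in \<^const>\<open>extensional\<close> makes uniqueness refer to the values
  on the domain only.\<close>

definition solves_kernel_eq ::
    "real \<Rightarrow> real \<Rightarrow> real \<Rightarrow> real \<Rightarrow> real \<Rightarrow> (real \<Rightarrow> real) \<Rightarrow>
     ((real \<times> real) \<times> real \<Rightarrow> real) \<Rightarrow> bool" where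
  "solves_kernel_eq t0 T \<alpha> lam0 c l K \<longleftrightarrow>
     K \<in> extensional (Kdom t0 T) \<and> Cn_on 2 (Kdom t0 T) K \<and>
     (\<forall>\<xi> \<eta> t. (\<xi>, \<eta>) \<in> Sbar \<and> t \<in> {t0..T} \<longrightarrow>
        d_t t0 T K ((\<xi>, \<eta>), t) =
          4 * \<alpha> / (l t)\<^sup>2 * d_xi t0 T (d_eta t0 T K) ((\<xi>, \<eta>), t)
          + tderiv t0 T 1 l t / l t *
              (\<xi> * d_xi t0 T K ((\<xi>, \<eta>), t) + \<eta> * d_eta t0 T K ((\<xi>, \<eta>), t))
          - lambda_bar t0 T \<alpha> lam0 c l \<xi> \<eta> t * K ((\<xi>, \<eta>), t)) \<and>
     (\<forall>\<xi> t. (\<xi>, \<xi>) \<in> Sbar \<and> t \<in> {t0..T} \<longrightarrow> K ((\<xi>, \<xi>), t) = 0) \<and>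
     (\<forall>\<xi> t. (\<xi>, 0) \<in> Sbar \<and> t \<in> {t0..T} \<longrightarrow> K ((\<xi>, 0), t) = f_bdry t0 T \<alpha> lam0 c l \<xi> t)"

definition kernel_op ::
    "real \<Rightarrow> real \<Rightarrow> real \<Rightarrow> real \<Rightarrow> real \<Rightarrow> (real \<Rightarrow> real) \<Rightarrow> (real \<times> real) \<times> real \<Rightarrow> real" where
  "kernel_op t0 T \<alpha> lam0 c l = (THE K. solves_kernel_eq t0 T \<alpha> lam0 c l K)"


section \<open>The target space\<close>

definition CK_metric :: "real \<Rightarrow> real \<Rightarrow> ((real \<times> real) \<times> real \<Rightarrow> real) metric" where
  "CK_metric t0 T = cfunspace (top_of_set (Kdom t0 T)) euclidean_metric"

definition XK :: "real \<Rightarrow> real \<Rightarrow> ((real \<times> real) \<times> real \<Rightarrow> real) set" where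
  "XK t0 T = {K \<in> mspace (CK_metric t0 T).
     \<forall>\<xi> t. (\<xi>, \<xi>) \<in> Sbar \<and> t \<in> {t0..T} \<longrightarrow> K ((\<xi>, \<xi>), t) = 0}"

end

theory Submission
  imports Defs
begin

text \<open>Solving the equation for \<open>\<partial>\<^sub>\<xi>\<partial>\<^sub>\<eta>K\<close> and integrating over rectangles shows that the difference
  \<open>w\<close> of two kernels satisfies \<open>w = A w + e\<close>, where \<open>A\<close> is a Goursat integral operator which
  also involves \<open>\<partial>\<^sub>tw\<close>, has the coefficients of the fixed function \<open>l\<close>, and where \<open>e\<close> is small
  with the \<open>C\<^sup>2\<close> distance. Iteration loses one time derivative per step, so the identity is
  tested in \<open>t\<close> against \<open>\<theta>\<close> vanishing to order \<open>N\<close> at the ends of a short interval: every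
  \<open>\<partial>\<^sub>t\<close> moves to \<open>\<theta>\<close>. Since the coefficients are analytic, \<open>k\<close> derivatives cost about
  \<open>k!\<close>, whereas the \<open>k\<close>-fold double integral gains \<open>1 / (k!)\<^sup>2\<close>. After \<open>N\<close> steps the
  remainder is \<open>O(X ^ N / N!)\<close>. Together with the uniform Lipschitz bound of \<open>w\<close> in \<open>t\<close> this
  controls \<open>w\<close> pointwise: first the interval is chosen short, then \<open>N\<close> large, then the distance
  small.\<close>

section \<open>Jets of analytic functions of time\<close>

text \<open>The obstacle is that \<open>t\<close> is no direction of propagation. Solved for the
  mixed derivative, the equation is a Goursat problem in \<open>(\<xi>, \<eta>)\<close> without
  initial data in \<open>t\<close>, and the time derivative of \<open>w\<close> is a source term
  that is bounded but not known to be small, so a Gronwall estimate in the supremum norm does not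
  close. Nor can \<open>w\<close> be differentiated repeatedly, being only twice differentiable. The
  way out is duality, as in Holmgren's uniqueness theorem. Since no nonzero analytic function has
  compact support, the cut-off is a polynomial whose order of vanishing grows with the number of
  steps while the growth ratio of its Taylor coefficients stays fixed. The derivative bound holds
  for each function separately, so only coefficients of one function \<open>l\<close> are iterated;
  its neighbour enters through the size of the defect, and continuity is proved at one
  \<open>l\<close> at a time. A function of time is carried as its Taylor series \<open>u t\<close>
  at every \<open>t\<close>. Coefficient 0 is the value, the time derivative is
  \<open>fps_deriv\<close>, and the factorials of high derivatives are absorbed into the
  coefficients.\<close>

definition taylor_jet_on :: "real set \<Rightarrow> (real \<Rightarrow> real fps) \<Rightarrow> bool" where
  "taylor_jet_on J u \<longleftrightarrow> (\<forall>t\<in>J. \<forall>j.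
     ((\<lambda>s. fps_nth (u s) j) has_real_derivative fps_nth (fps_deriv (u t)) j) (at t within J))"

lemma taylor_jet_onD:
  assumes "taylor_jet_on J u" "t \<in> J"
  shows "((\<lambda>s. fps_nth (u s) j) has_real_derivative fps_nth (fps_deriv (u t)) j) (at t within J)"
  using assms by (auto simp: taylor_jet_on_def)

lemma taylor_jet_on_continuous:
  assumes "taylor_jet_on J u"
  shows "continuous_on J (\<lambda>s. fps_nth (u s) j)"
  by (rule DERIV_continuous_on) (rule taylor_jet_onD[OF assms])

lemma taylor_jet_on_subset:
  assumes "taylor_jet_on J u" "I \<subseteq> J"
  shows "taylor_jet_on I u"
  using assms unfolding taylor_jet_on_def by (meson DERIV_subset subsetD)

lemma taylor_jet_on_const: "taylor_jet_on J (\<lambda>_. fps_const c)"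
  unfolding taylor_jet_on_def by simp

lemma taylor_jet_on_add:
  assumes "taylor_jet_on J u" "taylor_jet_on J v"
  shows "taylor_jet_on J (\<lambda>t. u t + v t)"
  using assms unfolding taylor_jet_on_def by (auto intro!: derivative_eq_intros simp del: fps_deriv_nth)

lemma taylor_jet_on_deriv:
  assumes "taylor_jet_on J u"
  shows "taylor_jet_on J (\<lambda>t. fps_deriv (u t))"
  unfolding taylor_jet_on_def
proof (intro ballI allI)
  fix t j assume "t \<in> J"
  then have "((\<lambda>s. real (j + 1) * fps_nth (u s) (j + 1)) has_real_derivative
      real (j + 1) * fps_nth (fps_deriv (u t)) (j + 1)) (at t within J)"
    by (intro DERIV_cmult taylor_jet_onD[OF assms])
  then show "((\<lambda>s. fps_nth (fps_deriv (u s)) j) has_real_derivative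
      fps_nth (fps_deriv (fps_deriv (u t))) j) (at t within J)"
    by simp
qed

text \<open>With the factorials inside the coefficients, the Leibniz rules of all orders are one
  statement: the termwise derivative of the Cauchy product is a coefficient of
  \<open>fps_deriv (u t * v t)\<close>.\<close>

lemma taylor_jet_on_mult:
  assumes "taylor_jet_on J u" "taylor_jet_on J v"
  shows "taylor_jet_on J (\<lambda>t. u t * v t)"
  unfolding taylor_jet_on_def
proof (intro ballI allI)
  fix t j assume t: "t \<in> J"
  have "((\<lambda>s. \<Sum>i=0..j. fps_nth (u s) i * fps_nth (v s) (j - i)) has_real_derivative
      (\<Sum>i=0..j. fps_nth (fps_deriv (u t)) i * fps_nth (v t) (j - i)
        + fps_nth (fps_deriv (v t)) (j - i) * fps_nth (u t) i)) (at t within J)"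
    by (intro DERIV_sum DERIV_mult taylor_jet_onD[OF assms(1) t] taylor_jet_onD[OF assms(2) t])
  moreover have "(\<Sum>i=0..j. fps_nth (fps_deriv (u t)) i * fps_nth (v t) (j - i)
        + fps_nth (fps_deriv (v t)) (j - i) * fps_nth (u t) i) =
      fps_nth (fps_deriv (u t) * v t + u t * fps_deriv (v t)) j"
    unfolding fps_add_nth fps_mult_nth by (simp add: sum.distrib mult_ac)
  moreover have "fps_deriv (u t) * v t + u t * fps_deriv (v t) = fps_deriv (u t * v t)"
    by (simp add: add.commute)
  ultimately show "((\<lambda>s. fps_nth (u s * v s) j) has_real_derivative
      fps_nth (fps_deriv (u t * v t)) j) (at t within J)"
    unfolding fps_mult_nth by simp
qed

lemma taylor_jet_on_power:
  assumes "taylor_jet_on J u"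
  shows "taylor_jet_on J (\<lambda>t. u t ^ n)"
proof (induction n)
  case 0
  then show ?case using taylor_jet_on_const[of J 1] by simp
next
  case (Suc n)
  then show ?case using taylor_jet_on_mult[OF assms] by simp
qed

section \<open>Geometric bounds for Taylor coefficients\<close>

definition geometrically_bounded_on :: "real set \<Rightarrow> (real \<Rightarrow> real fps) \<Rightarrow> bool" where
  "geometrically_bounded_on J u \<longleftrightarrow> (\<exists>A \<rho>. \<forall>t\<in>J. \<forall>j. \<bar>fps_nth (u t) j\<bar> \<le> A * \<rho> ^ j)"

text \<open>Stated for all larger constants, so that different coefficients can later share one
  \<open>A\<close> and one \<open>R\<close>.\<close>

lemma geometrically_bounded_onE:
  assumes "geometrically_bounded_on J u"
  obtains A \<rho> where "A > 0" "\<rho> > 0"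
    "\<And>B \<sigma> t j. A \<le> B \<Longrightarrow> \<rho> \<le> \<sigma> \<Longrightarrow> t \<in> J \<Longrightarrow> \<bar>fps_nth (u t) j\<bar> \<le> B * \<sigma> ^ j"
proof -
  obtain A \<rho> where *: "\<And>t j. t \<in> J \<Longrightarrow> \<bar>fps_nth (u t) j\<bar> \<le> A * \<rho> ^ j"
    using assms unfolding geometrically_bounded_on_def by metis
  show ?thesis
  proof (rule that[of "\<bar>A\<bar> + 1" "\<bar>\<rho>\<bar> + 1"])
    fix B \<sigma> t j assume h: "\<bar>A\<bar> + 1 \<le> B" "\<bar>\<rho>\<bar> + 1 \<le> \<sigma>" "t \<in> J"
    have "\<bar>fps_nth (u t) j\<bar> \<le> \<bar>A\<bar> * \<bar>\<rho>\<bar> ^ j"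
      using order_trans[OF *[OF h(3), of j] abs_ge_self] by (simp add: abs_mult power_abs)
    also have "\<dots> \<le> B * \<sigma> ^ j"
      using h by (intro mult_mono power_mono) auto
    finally show "\<bar>fps_nth (u t) j\<bar> \<le> B * \<sigma> ^ j" .
  qed auto
qed

lemma geometrically_bounded_on_const: "geometrically_bounded_on J (\<lambda>_. fps_const c)"
  unfolding geometrically_bounded_on_def by (intro exI[of _ "\<bar>c\<bar>"] exI[of _ 1]) auto

lemma geometrically_bounded_on_add:
  assumes "geometrically_bounded_on J u" "geometrically_bounded_on J v"
  shows "geometrically_bounded_on J (\<lambda>t. u t + v t)"
proof -
  obtain A \<rho> where A: "A > 0" "\<rho> > 0"
    "\<And>B \<sigma> t j. A \<le> B \<Longrightarrow> \<rho> \<le> \<sigma> \<Longrightarrow> t \<in> J \<Longrightarrow> \<bar>fps_nth (u t) j\<bar> \<le> B * \<sigma> ^ j"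
    by (rule geometrically_bounded_onE[OF assms(1)]) (rule that)
  obtain B \<sigma> where B: "B > 0" "\<sigma> > 0"
    "\<And>B' \<sigma>' t j. B \<le> B' \<Longrightarrow> \<sigma> \<le> \<sigma>' \<Longrightarrow> t \<in> J \<Longrightarrow> \<bar>fps_nth (v t) j\<bar> \<le> B' * \<sigma>' ^ j"
    by (rule geometrically_bounded_onE[OF assms(2)]) (rule that)
  define m where "m = max \<rho> \<sigma>"
  have "\<bar>fps_nth (u t + v t) j\<bar> \<le> (A + B) * m ^ j" if t: "t \<in> J" for t j
  proof -
    have "\<bar>fps_nth (u t) j\<bar> \<le> A * m ^ j" "\<bar>fps_nth (v t) j\<bar> \<le> B * m ^ j"
      using A(3)[OF order_refl _ t] B(3)[OF order_refl _ t] by (auto simp: m_def)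
    then show ?thesis unfolding fps_add_nth distrib_right by linarith
  qed
  then show ?thesis unfolding geometrically_bounded_on_def
    by (intro exI[of _ "A + B"] exI[of _ m]) simp
qed

text \<open>Differentiation and the Cauchy product both produce a factor \<open>j + 1\<close>;
  doubling the geometric ratio absorbs it.\<close>

lemma Suc_le_two_power: "real j + 1 \<le> 2 ^ j"
  by (induction j) auto

lemma geometrically_bounded_on_deriv:
  assumes "geometrically_bounded_on J u"
  shows "geometrically_bounded_on J (\<lambda>t. fps_deriv (u t))"
proof -
  obtain A \<rho> where A: "A > 0" "\<rho> > 0"
    "\<And>B \<sigma> t j. A \<le> B \<Longrightarrow> \<rho> \<le> \<sigma> \<Longrightarrow> t \<in> J \<Longrightarrow> \<bar>fps_nth (u t) j\<bar> \<le> B * \<sigma> ^ j"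
    by (rule geometrically_bounded_onE[OF assms]) (rule that)
  have "\<bar>fps_nth (fps_deriv (u t)) j\<bar> \<le> (A * \<rho>) * (2 * \<rho>) ^ j" if "t \<in> J" for t j
  proof -
    have "\<bar>fps_nth (fps_deriv (u t)) j\<bar> = (real j + 1) * \<bar>fps_nth (u t) (j + 1)\<bar>"
      by (simp add: abs_mult)
    also have "\<dots> \<le> 2 ^ j * (A * \<rho> ^ (j + 1))"
      using A(3)[of A \<rho> t "j + 1"] that Suc_le_two_power[of j] by (intro mult_mono) auto
    finally show ?thesis by (simp add: power_mult_distrib mult_ac)
  qed
  then show ?thesis unfolding geometrically_bounded_on_def
    by (intro exI[of _ "A * \<rho>"] exI[of _ "2 * \<rho>"]) simp
qed

lemma geometrically_bounded_on_mult:
  assumes "geometrically_bounded_on J u" "geometrically_bounded_on J v"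
  shows "geometrically_bounded_on J (\<lambda>t. u t * v t)"
proof -
  obtain A \<rho> where A: "A > 0" "\<rho> > 0"
    "\<And>B \<sigma> t j. A \<le> B \<Longrightarrow> \<rho> \<le> \<sigma> \<Longrightarrow> t \<in> J \<Longrightarrow> \<bar>fps_nth (u t) j\<bar> \<le> B * \<sigma> ^ j"
    by (rule geometrically_bounded_onE[OF assms(1)]) (rule that)
  obtain B \<sigma> where B: "B > 0" "\<sigma> > 0"
    "\<And>B' \<sigma>' t j. B \<le> B' \<Longrightarrow> \<sigma> \<le> \<sigma>' \<Longrightarrow> t \<in> J \<Longrightarrow> \<bar>fps_nth (v t) j\<bar> \<le> B' * \<sigma>' ^ j"
    by (rule geometrically_bounded_onE[OF assms(2)]) (rule that)
  define m where "m = max \<rho> \<sigma>"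
  have "\<bar>fps_nth (u t * v t) j\<bar> \<le> (A * B) * (2 * m) ^ j" if "t \<in> J" for t j
  proof -
    have "\<bar>fps_nth (u t * v t) j\<bar> \<le> (\<Sum>i=0..j. \<bar>fps_nth (u t) i * fps_nth (v t) (j - i)\<bar>)"
      unfolding fps_mult_nth by (rule sum_abs)
    also have "\<dots> \<le> (\<Sum>i=0..j. A * B * m ^ j)"
    proof (rule sum_mono)
      fix i assume i: "i \<in> {0..j}"
      have "\<bar>fps_nth (u t) i * fps_nth (v t) (j - i)\<bar> \<le> (A * m ^ i) * (B * m ^ (j - i))"
        unfolding abs_mult using A(3)[of A m t i] B(3)[of B m t "j - i"] that A(1)
        by (intro mult_mono) (auto simp: m_def)
      also have "\<dots> = A * B * m ^ (i + (j - i))"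
        by (simp add: power_add)
      finally show "\<bar>fps_nth (u t) i * fps_nth (v t) (j - i)\<bar> \<le> A * B * m ^ j"
        using i by simp
    qed
    also have "\<dots> = (real j + 1) * (A * B * m ^ j)" by simp
    also have "\<dots> \<le> 2 ^ j * (A * B * m ^ j)"
      using A B by (intro mult_right_mono Suc_le_two_power) (auto simp: m_def)
    finally show ?thesis by (simp add: power_mult_distrib mult_ac)
  qed
  then show ?thesis unfolding geometrically_bounded_on_def
    by (intro exI[of _ "A * B"] exI[of _ "2 * m"]) simp
qed

lemma sum_half_powers: "(\<Sum>i=0..j. (1 / 2) ^ i) = (2 - (1 / 2) ^ j :: real)"
  by (induction j) auto

section \<open>Analytic jets and weighted classes of test functions\<close>

definition analytic_jet_on :: "real set \<Rightarrow> (real \<Rightarrow> real fps) \<Rightarrow> bool" where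
  "analytic_jet_on J u \<longleftrightarrow> taylor_jet_on J u \<and> geometrically_bounded_on J u"

lemma analytic_jet_on_const: "analytic_jet_on J (\<lambda>_. fps_const c)"
  and analytic_jet_on_add:
    "\<lbrakk>analytic_jet_on J u; analytic_jet_on J v\<rbrakk> \<Longrightarrow> analytic_jet_on J (\<lambda>t. u t + v t)"
  and analytic_jet_on_mult:
    "\<lbrakk>analytic_jet_on J u; analytic_jet_on J v\<rbrakk> \<Longrightarrow> analytic_jet_on J (\<lambda>t. u t * v t)"
  and analytic_jet_on_deriv:
    "analytic_jet_on J u \<Longrightarrow> analytic_jet_on J (\<lambda>t. fps_deriv (u t))"
  by (simp_all add: analytic_jet_on_def taylor_jet_on_const taylor_jet_on_add taylor_jet_on_mult
      taylor_jet_on_deriv geometrically_bounded_on_const geometrically_bounded_on_add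
      geometrically_bounded_on_mult geometrically_bounded_on_deriv)

text \<open>Multiplication by a coefficient whose Taylor coefficients grow at most half as fast as
  \<open>R\<close> costs only a constant factor; this is why \<open>R / 2\<close> appears.\<close>

definition growth_class :: "real \<Rightarrow> real \<Rightarrow> real \<Rightarrow> nat \<Rightarrow> nat \<Rightarrow> real \<Rightarrow> (real \<Rightarrow> real fps) \<Rightarrow> bool" where
  "growth_class p q R k n C u \<longleftrightarrow> taylor_jet_on {p..q} u \<and>
     (\<forall>t\<in>{p..q}. \<forall>j. \<bar>fps_nth (u t) j\<bar> \<le> C * R ^ j * (fact (j + n) / fact j)) \<and>
     (\<forall>t\<in>{p, q}. \<forall>j<k. fps_nth (u t) j = 0)"

text \<open>The weight equals \<open>fact n * ((j + n) choose n)\<close>, which increases with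
  \<open>j\<close> and can therefore be taken out of the Cauchy product; what remains is a geometric
  series of ratio 1 / 2. Vanishing at the ends survives because coefficient \<open>j\<close> of the
  product involves only coefficients of \<open>v\<close> up to \<open>j\<close>.\<close>

lemma growth_class_mult:
  assumes u: "taylor_jet_on {p..q} u" "\<And>t j. t \<in> {p..q} \<Longrightarrow> \<bar>fps_nth (u t) j\<bar> \<le> A * (R / 2) ^ j"
    and v: "growth_class p q R k n C v" and "0 \<le> A" "0 < R" "0 \<le> C"
  shows "growth_class p q R k n (2 * A * C) (\<lambda>t. u t * v t)"
proof -
  have "\<bar>fps_nth (u t * v t) j\<bar> \<le> 2 * A * C * R ^ j * (fact (j + n) / fact j)" if t: "t \<in> {p..q}" for t j
  proof -
    let ?B = "A * C * R ^ j * (fact (j + n) / fact j)"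
    have "\<bar>fps_nth (u t * v t) j\<bar> \<le> (\<Sum>i=0..j. \<bar>fps_nth (u t) i * fps_nth (v t) (j - i)\<bar>)"
      unfolding fps_mult_nth by (rule sum_abs)
    also have "\<dots> \<le> (\<Sum>i=0..j. ?B * (1 / 2) ^ i)"
    proof (rule sum_mono)
      fix i assume i: "i \<in> {0..j}"
      have "fact (j - i + n) / fact (j - i) = (fact n * ((j - i + n) choose n) :: real)"
        by (simp add: binomial_fact)
      also have "\<dots> \<le> fact n * ((j + n) choose n)"
        by (intro mult_left_mono of_nat_mono binomial_right_mono) auto
      also have "\<dots> = fact (j + n) / fact j" by (simp add: binomial_fact)
      finally have f: "fact (j - i + n) / fact (j - i) \<le> (fact (j + n) / fact j :: real)" .
      have "\<bar>fps_nth (u t) i * fps_nth (v t) (j - i)\<bar>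
          \<le> (A * (R / 2) ^ i) * (C * R ^ (j - i) * (fact (j - i + n) / fact (j - i)))"
        unfolding abs_mult using assms u(2)[OF t, of i] v t
        by (intro mult_mono) (auto simp: growth_class_def)
      also have "\<dots> \<le> (A * (R / 2) ^ i) * (C * R ^ (j - i) * (fact (j + n) / fact j))"
        using assms f by (intro mult_left_mono) auto
      also have "\<dots> = A * C * R ^ (i + (j - i)) * (fact (j + n) / fact j) * (1 / 2) ^ i"
        by (simp add: power_add power_divide mult_ac)
      finally show "\<bar>fps_nth (u t) i * fps_nth (v t) (j - i)\<bar> \<le> ?B * (1 / 2) ^ i"
        using i by simp
    qed
    also have "\<dots> = ?B * (\<Sum>i=0..j. (1 / 2) ^ i)" by (simp add: sum_distrib_left)
    also have "\<dots> \<le> ?B * 2"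
    proof (rule mult_left_mono)
      show "(\<Sum>i=0..j. (1 / 2) ^ i) \<le> (2::real)"
        using sum_half_powers[of j] by simp
    qed (use assms in auto)
    finally show ?thesis by (simp add: mult_ac)
  qed
  moreover have "fps_nth (u t * v t) j = 0" if "t \<in> {p, q}" "j < k" for t j
    using v that unfolding fps_mult_nth growth_class_def by (intro sum.neutral) auto
  ultimately show ?thesis
    using taylor_jet_on_mult[OF u(1)] v by (auto simp: growth_class_def)
qed

text \<open>The weight \<open>fact (j + n) / fact j\<close> is the factor that \<open>n\<close>
  differentiations put in front of a geometric coefficient. One more differentiation turns
  \<open>n\<close> into \<open>Suc n\<close> exactly, at the price of a factor \<open>R\<close> and
  of one order of vanishing at the ends.\<close>

lemma growth_class_deriv:
  assumes "growth_class p q R (Suc k) n C v"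
  shows "growth_class p q R k (Suc n) (C * R) (\<lambda>t. fps_deriv (v t))"
proof -
  have "\<bar>fps_nth (fps_deriv (v t)) j\<bar> \<le> C * R * R ^ j * (fact (j + Suc n) / fact j)" if "t \<in> {p..q}" for t j
  proof -
    have "\<bar>fps_nth (fps_deriv (v t)) j\<bar> = (real j + 1) * \<bar>fps_nth (v t) (j + 1)\<bar>"
      by (simp add: abs_mult)
    also have "\<dots> \<le> (real j + 1) * (C * R ^ (j + 1) * (fact (j + 1 + n) / fact (j + 1)))"
      using assms that unfolding growth_class_def by (intro mult_left_mono) (blast, simp)
    also have "\<dots> = C * R * R ^ j * (fact (j + Suc n) / fact j)"
    proof -
      have "fact (j + 1) = (real j + 1) * fact j" by (simp add: add.commute)
      then have "(real j + 1) * (fact (j + 1 + n) / fact (j + 1)) = fact (j + Suc n) / fact j"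
        by (simp del: fact_Suc)
      moreover have "(real j + 1) * (C * R ^ (j + 1) * y) = C * R * R ^ j * ((real j + 1) * y)" for y
        by (simp add: mult_ac)
      ultimately show ?thesis by metis
    qed
    finally show ?thesis .
  qed
  moreover have "\<forall>t\<in>{p, q}. \<forall>j<k. fps_nth (fps_deriv (v t)) j = 0"
    using assms by (simp add: growth_class_def)
  ultimately show ?thesis
    using assms taylor_jet_on_deriv[of "{p..q}" v] unfolding growth_class_def by blast
qed

lemma growth_class_nth_0:
  assumes "growth_class p q R k n C v" "t \<in> {p..q}"
  shows "\<bar>fps_nth (v t) 0\<bar> \<le> C * fact n"
proof -
  have "\<bar>fps_nth (v t) 0\<bar> \<le> C * R ^ 0 * (fact (0 + n) / fact 0)"
    using assms unfolding growth_class_def by blast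
  then show ?thesis by simp
qed

lemma growth_class_mono:
  assumes "growth_class p q R k n C v" "k' \<le> k"
  shows "growth_class p q R k' n C v"
  using assms by (auto simp: growth_class_def)


section \<open>Moments of approximate solutions of a Goursat problem\<close>

lemma integral_swap3:
  fixes f :: "real \<Rightarrow> real \<Rightarrow> real \<Rightarrow> real"
  assumes "continuous_on ({p..q} \<times> {c..d} \<times> {e..g}) (\<lambda>(t, r, s). f t r s)"
  shows "integral {p..q} (\<lambda>t. integral {c..d} (\<lambda>r. integral {e..g} (\<lambda>s. f t r s))) =
         integral {c..d} (\<lambda>r. integral {e..g} (\<lambda>s. integral {p..q} (\<lambda>t. f t r s)))"
proof -
  have "continuous_on (({p..q} \<times> {c..d}) \<times> cbox e g) (\<lambda>(u, s). f (fst u) (snd u) s)"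
    unfolding case_prod_beta
    by (rule continuous_on_compose2[OF assms, of _ "\<lambda>v. (fst (fst v), snd (fst v), snd v)",
          unfolded case_prod_beta fst_conv snd_conv])
       (auto intro!: continuous_intros)
  then have "continuous_on ({p..q} \<times> {c..d}) (\<lambda>u. integral (cbox e g) (\<lambda>s. f (fst u) (snd u) s))"
    by (rule integral_continuous_on_param)
  then have "continuous_on (cbox (p, c) (q, d)) (\<lambda>(t, r). integral {e..g} (\<lambda>s. f t r s))"
    by (simp add: cbox_Pair_eq case_prod_beta)
  then have "integral {p..q} (\<lambda>t. integral {c..d} (\<lambda>r. integral {e..g} (\<lambda>s. f t r s))) =
      integral {c..d} (\<lambda>r. integral {p..q} (\<lambda>t. integral {e..g} (\<lambda>s. f t r s)))"
    using integral_swap_continuous[of p c q d "\<lambda>t r. integral {e..g} (\<lambda>s. f t r s)"] by simp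
  also have "\<dots> = integral {c..d} (\<lambda>r. integral {e..g} (\<lambda>s. integral {p..q} (\<lambda>t. f t r s)))"
  proof (rule integral_cong)
    fix r assume r: "r \<in> {c..d}"
    have "continuous_on (cbox (p, e) (q, g)) (\<lambda>(t, s). f t r s)"
      unfolding case_prod_beta
      by (rule continuous_on_compose2[OF assms, of _ "\<lambda>v. (fst v, r, snd v)",
            unfolded case_prod_beta fst_conv snd_conv])
         (use r in \<open>auto simp: cbox_Pair_eq intro!: continuous_intros\<close>)
    then show "integral {p..q} (\<lambda>t. integral {e..g} (\<lambda>s. f t r s)) =
        integral {e..g} (\<lambda>s. integral {p..q} (\<lambda>t. f t r s))"
      using integral_swap_continuous[of p e q g "\<lambda>t s. f t r s"] by simp
  qed
  finally show ?thesis .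
qed

text \<open>In the moment estimate \<open>\<alpha>\<close> carries the defect and
  \<open>\<beta> * r ^ k\<close> the iteration, whose gain \<open>1 / (k + 1)\<close> must be kept.
  The lower limit contributes to the power term with a favourable sign and is dropped.\<close>

lemma abs_integral_le_affine_power:
  fixes f :: "real \<Rightarrow> real"
  assumes "0 \<le> c" "c \<le> d" "0 \<le> \<beta>" "continuous_on {c..d} f"
    and "\<And>r. r \<in> {c..d} \<Longrightarrow> \<bar>f r\<bar> \<le> \<alpha> + \<beta> * r ^ k"
  shows "\<bar>integral {c..d} f\<bar> \<le> \<alpha> * (d - c) + \<beta> * (d ^ (k + 1) / (k + 1))"
proof -
  have "((\<lambda>r. \<alpha> + \<beta> * r ^ k) has_integral
      (\<alpha> * d + \<beta> * (d ^ (k + 1) / (k + 1))) - (\<alpha> * c + \<beta> * (c ^ (k + 1) / (k + 1)))) {c..d}"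
  proof (rule fundamental_theorem_of_calculus[OF assms(2)])
    fix r assume "r \<in> {c..d}"
    have *: "((\<lambda>r. r ^ (k + 1) / (k + 1)) has_real_derivative r ^ k) (at r within {c..d})"
      using DERIV_cdivide[OF DERIV_pow[of "k + 1" r "{c..d}"], of "k + 1"] by simp
    have "((\<lambda>r. \<alpha> * r + \<beta> * (r ^ (k + 1) / (k + 1))) has_real_derivative \<alpha> + \<beta> * r ^ k)
        (at r within {c..d})"
      using DERIV_add[OF DERIV_cmult[OF DERIV_ident, of \<alpha>] DERIV_cmult[OF *, of \<beta>]] by simp
    then show "((\<lambda>r. \<alpha> * r + \<beta> * (r ^ (k + 1) / (k + 1))) has_vector_derivative \<alpha> + \<beta> * r ^ k)
        (at r within {c..d})"
      by (simp add: has_real_derivative_iff_has_vector_derivative)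
  qed
  then have I: "(\<lambda>r. \<alpha> + \<beta> * r ^ k) integrable_on {c..d}"
    "integral {c..d} (\<lambda>r. \<alpha> + \<beta> * r ^ k) =
      (\<alpha> * d + \<beta> * (d ^ (k + 1) / (k + 1))) - (\<alpha> * c + \<beta> * (c ^ (k + 1) / (k + 1)))"
    by (auto simp: has_integral_integrable_integral)
  have "norm (integral {c..d} f) \<le> integral {c..d} (\<lambda>r. \<alpha> + \<beta> * r ^ k)"
    by (rule integral_norm_bound_integral)
       (use assms I integrable_continuous_real in auto)
  also have "\<dots> \<le> \<alpha> * (d - c) + \<beta> * (d ^ (k + 1) / (k + 1))"
    unfolding I using assms by (simp add: algebra_simps)
  finally show ?thesis by simp
qed

text \<open>The last two bounds keep the iteration free of geometric factors:
  \<open>(x - y) * y\<close> is the area of the rectangle of integration, and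
  \<open>(x * y) ^ k\<close> is what \<open>k\<close> double integrals build up.\<close>

lemma SbarD:
  assumes "(x, y) \<in> Sbar"
  shows "0 \<le> y" "y \<le> x" "x \<le> 2 - y" "0 \<le> x" "x \<le> 2" "y \<le> 1" "x * y \<le> 1" "(x - y) * y \<le> 1"
proof -
  show h: "0 \<le> y" "y \<le> x" "x \<le> 2 - y" "0 \<le> x" "x \<le> 2" "y \<le> 1"
    using assms by (auto simp: Sbar_def)
  have "x * y \<le> (2 - y) * y" using h by (intro mult_right_mono) auto
  also have "\<dots> = 1 - (1 - y)\<^sup>2" by (simp add: power2_eq_square algebra_simps)
  finally show "x * y \<le> 1" by (smt (verit) zero_le_power2)
  then show "(x - y) * y \<le> 1" using h by (smt (verit) mult_right_mono)
qed

text \<open>Hence the integral equation refers to values in the triangle only. The rectangle has the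
  corner \<open>(y, y)\<close> on the diagonal and an edge on \<open>\<eta> = 0\<close>, where the
  kernel is prescribed.\<close>

lemma Sbar_rectangle:
  assumes "(x, y) \<in> Sbar" "s \<in> {y..x}" "r \<in> {0..y}"
  shows "(s, r) \<in> Sbar"
  using assms by (auto simp: Sbar_def)

lemma compact_Sbar: "compact Sbar"
proof -
  have "Sbar = {z. 0 \<le> snd z} \<inter> {z. snd z \<le> fst z} \<inter> {z. fst z \<le> 2 - snd z}"
    by (auto simp: Sbar_def)
  moreover have "closed \<dots>"
    by (intro closed_Int closed_Collect_le continuous_intros)
  moreover have "Sbar \<subseteq> cbox (0, 0) (2, 1)"
    by (auto simp: Sbar_def cbox_Pair_eq)
  then have "bounded Sbar" using bounded_cbox bounded_subset by blast
  ultimately show ?thesis by (simp add: compact_eq_bounded_closed)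
qed

text \<open>The right-hand side of the kernel equation, solved for \<open>\<partial>\<^sub>\<xi>\<partial>\<^sub>\<eta>K\<close> and integrated over
  \<open>{y..x} \<times> {0..y}\<close>, with the first-order terms in \<open>\<xi>\<close> and \<open>\<eta>\<close> integrated by parts;
  \<open>u'\<close> stands for the time derivative.\<close>

definition goursat_op ::
    "real \<Rightarrow> real \<Rightarrow> real \<Rightarrow> real \<Rightarrow> (real \<times> real \<Rightarrow> real) \<Rightarrow> (real \<times> real \<Rightarrow> real) \<Rightarrow> real \<Rightarrow> real \<Rightarrow> real" where
  "goursat_op a b d0 d1 u u' x y =
     integral {0..y} (\<lambda>r. integral {y..x} (\<lambda>s. a * u' (s, r) + (d0 + (s - r) * d1) * u (s, r)))
     - b * (integral {0..y} (\<lambda>r. x * u (x, r) - y * u (y, r)) + y * integral {y..x} (\<lambda>s. u (s, y)))"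

text \<open>The defect accumulated in \<open>k\<close> steps on a window of length \<open>L\<close>.
  Each step adds a new \<open>L * fact n\<close>; the shift to \<open>Suc n\<close> comes from the
  differentiated term, and 6 collects 1 + 2 from \<open>d0\<close> and \<open>(s - r) * d1\<close>
  and 3 from the terms with \<open>b\<close>. Its growth in \<open>k\<close> is harmless, because
  the defect is made small after the number of steps has been fixed.\<close>

fun defect_const :: "real \<Rightarrow> real \<Rightarrow> real \<Rightarrow> nat \<Rightarrow> nat \<Rightarrow> real" where
  "defect_const L A R 0 n = 0"
| "defect_const L A R (Suc k) n = L * fact n
     + 2 * A * (R * defect_const L A R k (Suc n) + 6 * defect_const L A R k n)"

lemma defect_const_nonneg:
  assumes "0 \<le> L" "0 \<le> A" "0 \<le> R"
  shows "0 \<le> defect_const L A R k n"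
  using assms by (induction k arbitrary: n) auto

text \<open>One time window. The jets will be those of the fixed boundary function, so
  \<open>A\<close> and \<open>R\<close> do not depend on the function it is compared with, which is
  felt only through \<open>w\<close>, \<open>M\<close> and \<open>\<delta>\<close>. The ratio
  \<open>R / 2\<close> is the one demanded by \<open>growth_class_mult\<close>.\<close>

locale approximate_goursat =
  fixes p q A R M \<delta> :: real and w w' :: "(real \<times> real) \<times> real \<Rightarrow> real"
    and a b d0 d1 :: "real \<Rightarrow> real fps"
  assumes pq: "p \<le> q"
    and A: "0 \<le> A" and R: "0 < R"
    and w_cont: "continuous_on (Sbar \<times> {p..q}) w"
    and w'_cont: "continuous_on (Sbar \<times> {p..q}) w'"
    and w_deriv: "\<And>z t. z \<in> Sbar \<Longrightarrow> t \<in> {p..q} \<Longrightarrow>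
      ((\<lambda>t. w (z, t)) has_real_derivative w' (z, t)) (at t within {p..q})"
    and w_bound: "\<And>z t. z \<in> Sbar \<Longrightarrow> t \<in> {p..q} \<Longrightarrow> \<bar>w (z, t)\<bar> \<le> M"
    and jets: "taylor_jet_on {p..q} a" "taylor_jet_on {p..q} b"
      "taylor_jet_on {p..q} d0" "taylor_jet_on {p..q} d1"
    and coeff_bound: "\<And>t j. t \<in> {p..q} \<Longrightarrow> \<bar>fps_nth (a t) j\<bar> \<le> A * (R / 2) ^ j"
      "\<And>t j. t \<in> {p..q} \<Longrightarrow> \<bar>fps_nth (b t) j\<bar> \<le> A * (R / 2) ^ j"
      "\<And>t j. t \<in> {p..q} \<Longrightarrow> \<bar>fps_nth (d0 t) j\<bar> \<le> A * (R / 2) ^ j"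
      "\<And>t j. t \<in> {p..q} \<Longrightarrow> \<bar>fps_nth (d1 t) j\<bar> \<le> A * (R / 2) ^ j"
    and defect: "\<And>x y t. (x, y) \<in> Sbar \<Longrightarrow> t \<in> {p..q} \<Longrightarrow>
      \<bar>w ((x, y), t) - goursat_op (fps_nth (a t) 0) (fps_nth (b t) 0) (fps_nth (d0 t) 0)
         (fps_nth (d1 t) 0) (\<lambda>z. w (z, t)) (\<lambda>z. w' (z, t)) x y\<bar> \<le> \<delta>"
begin

lemma continuous_on_w_comp:
  assumes "continuous_on X g" "\<And>u. u \<in> X \<Longrightarrow> g u \<in> Sbar \<times> {p..q}"
  shows "continuous_on X (\<lambda>u. w (g u))" "continuous_on X (\<lambda>u. w' (g u))"
  by (rule continuous_on_compose2[OF w_cont assms(1)] continuous_on_compose2[OF w'_cont assms(1)];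
      use assms(2) in blast)+

text \<open>Only coefficient 0 of \<open>\<theta>\<close> is integrated; the higher ones keep the
  derivatives in store for later integrations by parts.\<close>

definition moment :: "(real \<Rightarrow> real fps) \<Rightarrow> real \<times> real \<Rightarrow> real" where
  "moment \<theta> z = integral {p..q} (\<lambda>t. w (z, t) * fps_nth (\<theta> t) 0)"

lemma continuous_on_moment:
  assumes "taylor_jet_on {p..q} \<theta>"
  shows "continuous_on Sbar (moment \<theta>)"
proof -
  have "continuous_on (Sbar \<times> cbox p q) (\<lambda>u. w u * fps_nth (\<theta> (snd u)) 0)"
    using w_cont
    by (intro continuous_intros continuous_on_compose2[OF taylor_jet_on_continuous[OF assms]]) auto
  then have "continuous_on Sbar (\<lambda>z. integral (cbox p q) (\<lambda>t. w (z, t) * fps_nth (\<theta> t) 0))"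
    by (intro integral_continuous_on_param) (simp add: case_prod_beta)
  then show ?thesis by (simp add: moment_def[abs_def])
qed

lemma moment_by_parts:
  assumes \<phi>: "taylor_jet_on {p..q} \<phi>" "\<And>t. t \<in> {p, q} \<Longrightarrow> fps_nth (\<phi> t) 0 = 0" and z: "z \<in> Sbar"
  shows "integral {p..q} (\<lambda>t. w' (z, t) * fps_nth (\<phi> t) 0) = - moment (\<lambda>t. fps_deriv (\<phi> t)) z"
proof -
  have c: "continuous_on {p..q} (\<lambda>t. w (z, t))" "continuous_on {p..q} (\<lambda>t. w' (z, t))"
    by (intro continuous_on_w_comp continuous_intros; use z in auto)+
  have i: "(\<lambda>t. w' (z, t) * fps_nth (\<phi> t) 0) integrable_on {p..q}"
    "(\<lambda>t. w (z, t) * fps_nth (fps_deriv (\<phi> t)) 0) integrable_on {p..q}"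
    by (intro integrable_continuous_real continuous_on_mult c taylor_jet_on_continuous
        taylor_jet_on_deriv \<phi>)+
  have "((\<lambda>t. w' (z, t) * fps_nth (\<phi> t) 0 + fps_nth (fps_deriv (\<phi> t)) 0 * w (z, t)) has_integral
      w (z, q) * fps_nth (\<phi> q) 0 - w (z, p) * fps_nth (\<phi> p) 0) {p..q}"
    unfolding has_real_derivative_iff_has_vector_derivative[symmetric]
    by (intro fundamental_theorem_of_calculus pq)
       (auto simp only: has_real_derivative_iff_has_vector_derivative[symmetric]
             intro!: DERIV_mult w_deriv z taylor_jet_onD[OF \<phi>(1)])
  then have "integral {p..q} (\<lambda>t. w' (z, t) * fps_nth (\<phi> t) 0 + w (z, t) * fps_nth (fps_deriv (\<phi> t)) 0) = 0"
    using \<phi>(2) by (simp add: mult.commute integral_unique)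
  then show ?thesis
    unfolding integral_add[OF i] moment_def by simp
qed

text \<open>The time integral commutes with the space integrals, and a coefficient depending on
  \<open>t\<close> alone can be moved from \<open>w\<close> to \<open>\<theta>\<close>. The
  right-hand side again consists of moments of \<open>w\<close>, taken with new test functions and
  free of time derivatives of \<open>w\<close>, so the step can be repeated.\<close>

lemma moment_defect:
  assumes \<theta>: "taylor_jet_on {p..q} \<theta>" "\<And>t. t \<in> {p, q} \<Longrightarrow> fps_nth (\<theta> t) 0 = 0"
    "\<And>t. t \<in> {p..q} \<Longrightarrow> \<bar>fps_nth (\<theta> t) 0\<bar> \<le> B"
    and xy: "(x, y) \<in> Sbar"
  shows "\<bar>moment \<theta> (x, y)
        - (integral {0..y} (\<lambda>r. integral {y..x} (\<lambda>s. - moment (\<lambda>t. fps_deriv (a t * \<theta> t)) (s, r)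
              + moment (\<lambda>t. d0 t * \<theta> t) (s, r) + (s - r) * moment (\<lambda>t. d1 t * \<theta> t) (s, r)))
          - (integral {0..y} (\<lambda>r. x * moment (\<lambda>t. b t * \<theta> t) (x, r) - y * moment (\<lambda>t. b t * \<theta> t) (y, r))
              + y * integral {y..x} (\<lambda>s. moment (\<lambda>t. b t * \<theta> t) (s, y))))\<bar>
    \<le> \<delta> * B * (q - p)"
proof -
  note xy' = SbarD[OF xy]
  define \<theta>0 where "\<theta>0 t = fps_nth (\<theta> t) 0" for t
  define a0 where "a0 t = fps_nth (a t) 0" for t
  define b0 where "b0 t = fps_nth (b t) 0" for t
  define d00 where "d00 t = fps_nth (d0 t) 0" for t
  define d10 where "d10 t = fps_nth (d1 t) 0" for t
  have cont: "continuous_on {p..q} \<theta>0" "continuous_on {p..q} a0" "continuous_on {p..q} b0"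
    "continuous_on {p..q} d00" "continuous_on {p..q} d10"
    unfolding \<theta>0_def[abs_def] a0_def[abs_def] b0_def[abs_def] d00_def[abs_def] d10_def[abs_def]
    by (intro taylor_jet_on_continuous \<theta> jets)+
  have cont': "continuous_on X (\<lambda>u. \<theta>0 (g u))" "continuous_on X (\<lambda>u. a0 (g u))"
    "continuous_on X (\<lambda>u. b0 (g u))" "continuous_on X (\<lambda>u. d00 (g u))" "continuous_on X (\<lambda>u. d10 (g u))"
    if "continuous_on X g" "\<And>u. u \<in> X \<Longrightarrow> g u \<in> {p..q}" for X and g :: "'b::topological_space \<Rightarrow> real"
    by (rule cont[THEN continuous_on_compose2]; use that in auto)+
  define F where "F t r s = (a0 t * w' ((s, r), t) + (d00 t + (s - r) * d10 t) * w ((s, r), t)) * \<theta>0 t" for t r s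
  define G where "G t r = (x * w ((x, r), t) - y * w ((y, r), t)) * (b0 t * \<theta>0 t)" for t r
  define H where "H t s = w ((s, y), t) * (b0 t * \<theta>0 t)" for t s
  have cF: "continuous_on ({p..q} \<times> {0..y} \<times> {y..x}) (\<lambda>(t, r, s). F t r s)"
    unfolding F_def case_prod_beta
    by (intro continuous_intros continuous_on_w_comp cont')
       (use Sbar_rectangle[OF xy] in \<open>auto simp: mem_Times_iff\<close>)
  have cG: "continuous_on ({p..q} \<times> {0..y}) (\<lambda>(t, r). G t r)"
    unfolding G_def case_prod_beta
    by (intro continuous_intros continuous_on_w_comp cont')
       (use Sbar_rectangle[OF xy] xy' in \<open>auto simp: mem_Times_iff\<close>)
  have cH: "continuous_on ({p..q} \<times> {y..x}) (\<lambda>(t, s). H t s)"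
    unfolding H_def case_prod_beta
    by (intro continuous_intros continuous_on_w_comp cont')
       (use Sbar_rectangle[OF xy] xy' in \<open>auto simp: mem_Times_iff\<close>)
  have cw: "continuous_on {p..q} (\<lambda>t. w (z, t))" "continuous_on {p..q} (\<lambda>t. w' (z, t))"
    if "z \<in> Sbar" for z
    by (intro continuous_on_w_comp continuous_intros; use that in auto)+

  have iF: "integral {p..q} (\<lambda>t. F t r s) = - moment (\<lambda>t. fps_deriv (a t * \<theta> t)) (s, r)
      + moment (\<lambda>t. d0 t * \<theta> t) (s, r) + (s - r) * moment (\<lambda>t. d1 t * \<theta> t) (s, r)"
    if r: "r \<in> {0..y}" and s: "s \<in> {y..x}" for r s
  proof -
    have z: "(s, r) \<in> Sbar" using Sbar_rectangle[OF xy s r] .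
    have "integral {p..q} (\<lambda>t. F t r s) = integral {p..q} (\<lambda>t. w' ((s, r), t) * (a0 t * \<theta>0 t)
        + w ((s, r), t) * (d00 t * \<theta>0 t) + (s - r) * (w ((s, r), t) * (d10 t * \<theta>0 t)))"
      by (simp add: F_def algebra_simps)
    also have "\<dots> = integral {p..q} (\<lambda>t. w' ((s, r), t) * (a0 t * \<theta>0 t))
        + integral {p..q} (\<lambda>t. w ((s, r), t) * (d00 t * \<theta>0 t))
        + (s - r) * integral {p..q} (\<lambda>t. w ((s, r), t) * (d10 t * \<theta>0 t))"
      by (subst integral_add, (intro integrable_continuous_real continuous_intros cw cont z)+)+ simp
    also have "integral {p..q} (\<lambda>t. w' ((s, r), t) * (a0 t * \<theta>0 t)) =
        - moment (\<lambda>t. fps_deriv (a t * \<theta> t)) (s, r)"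
      using moment_by_parts[OF taylor_jet_on_mult[OF jets(1) \<theta>(1)] _ z] \<theta>(2)
      by (simp add: a0_def \<theta>0_def)
    finally show ?thesis by (simp add: moment_def d00_def d10_def \<theta>0_def)
  qed
  have "integral {p..q} (\<lambda>t. integral {0..y} (\<lambda>r. integral {y..x} (F t r))) =
      integral {0..y} (\<lambda>r. integral {y..x} (\<lambda>s. integral {p..q} (\<lambda>t. F t r s)))"
    using integral_swap3[OF cF] .
  also have "\<dots> = integral {0..y} (\<lambda>r. integral {y..x} (\<lambda>s. - moment (\<lambda>t. fps_deriv (a t * \<theta> t)) (s, r)
              + moment (\<lambda>t. d0 t * \<theta> t) (s, r) + (s - r) * moment (\<lambda>t. d1 t * \<theta> t) (s, r)))"
    by (intro integral_cong) (simp add: iF)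
  finally have IF: "integral {p..q} (\<lambda>t. integral {0..y} (\<lambda>r. integral {y..x} (F t r))) = \<dots>" .

  have iG: "integral {p..q} (\<lambda>t. G t r) =
      x * moment (\<lambda>t. b t * \<theta> t) (x, r) - y * moment (\<lambda>t. b t * \<theta> t) (y, r)"
    if r: "r \<in> {0..y}" for r
  proof -
    have z: "(x, r) \<in> Sbar" "(y, r) \<in> Sbar" using Sbar_rectangle[OF xy _ r] xy' by auto
    have "integral {p..q} (\<lambda>t. G t r) = integral {p..q} (\<lambda>t. x * (w ((x, r), t) * (b0 t * \<theta>0 t))
        - y * (w ((y, r), t) * (b0 t * \<theta>0 t)))"
      by (simp add: G_def algebra_simps)
    also have "\<dots> = x * integral {p..q} (\<lambda>t. w ((x, r), t) * (b0 t * \<theta>0 t))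
        - y * integral {p..q} (\<lambda>t. w ((y, r), t) * (b0 t * \<theta>0 t))"
      by (subst integral_diff, (intro integrable_continuous_real continuous_intros cw cont z)+) simp
    finally show ?thesis by (simp add: moment_def b0_def \<theta>0_def)
  qed
  have "integral {p..q} (\<lambda>t. integral {0..y} (G t)) = integral {0..y} (\<lambda>r. integral {p..q} (\<lambda>t. G t r))"
    using integral_swap_continuous[of p 0 q y G] cG by (simp add: cbox_Pair_eq)
  also have "\<dots> = integral {0..y} (\<lambda>r. x * moment (\<lambda>t. b t * \<theta> t) (x, r) - y * moment (\<lambda>t. b t * \<theta> t) (y, r))"
    by (intro integral_cong) (simp add: iG)
  finally have IG: "integral {p..q} (\<lambda>t. integral {0..y} (G t)) = \<dots>" .

  have "integral {p..q} (\<lambda>t. integral {y..x} (H t)) = integral {y..x} (\<lambda>s. integral {p..q} (\<lambda>t. H t s))"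
    using integral_swap_continuous[of p y q x H] cH by (simp add: cbox_Pair_eq)
  also have "\<dots> = integral {y..x} (\<lambda>s. moment (\<lambda>t. b t * \<theta> t) (s, y))"
    by (simp add: H_def moment_def b0_def \<theta>0_def)
  finally have IH: "integral {p..q} (\<lambda>t. integral {y..x} (H t)) = \<dots>" .

  have cIF: "continuous_on {p..q} (\<lambda>t. integral {0..y} (\<lambda>r. integral {y..x} (F t r)))"
  proof -
    have "continuous_on (({p..q} \<times> {0..y}) \<times> cbox y x) (\<lambda>(u, s). F (fst u) (snd u) s)"
      unfolding case_prod_beta
      by (rule continuous_on_compose2[OF cF, of _ "\<lambda>v. (fst (fst v), snd (fst v), snd v)",
            unfolded case_prod_beta fst_conv snd_conv])
         (auto intro!: continuous_intros)
    then have "continuous_on ({p..q} \<times> cbox 0 y) (\<lambda>(t, r). integral (cbox y x) (F t r))"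
      unfolding case_prod_beta by (intro integral_continuous_on_param) (simp add: case_prod_beta)
    then show ?thesis using integral_continuous_on_param by fastforce
  qed
  have cIG: "continuous_on {p..q} (\<lambda>t. integral {0..y} (G t))"
    and cIH: "continuous_on {p..q} (\<lambda>t. integral {y..x} (H t))"
    using integral_continuous_on_param[of "{p..q}" 0 y G] cG
      integral_continuous_on_param[of "{p..q}" y x H] cH by simp_all
  define E where "E t = w ((x, y), t) * \<theta>0 t - (integral {0..y} (\<lambda>r. integral {y..x} (F t r))
      - (integral {0..y} (G t) + y * integral {y..x} (H t)))" for t
  have cE: "continuous_on {p..q} E"
    unfolding E_def[abs_def] by (intro continuous_intros cIF cIG cIH cw cont xy)
  have "\<bar>E t\<bar> \<le> \<delta> * B" if t: "t \<in> {p..q}" for t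
  proof -
    let ?D = "w ((x, y), t)
        - (integral {0..y} (\<lambda>r. integral {y..x} (\<lambda>s. a0 t * w' ((s, r), t)
              + (d00 t + (s - r) * d10 t) * w ((s, r), t)))
          - b0 t * (integral {0..y} (\<lambda>r. x * w ((x, r), t) - y * w ((y, r), t))
                + y * integral {y..x} (\<lambda>s. w ((s, y), t))))"
    \<comment> \<open>The test function does not depend on the space variables and leaves every
      inner integral, so that the pointwise defect bound applies.\<close>
    have "E t = ?D * \<theta>0 t"
      unfolding E_def F_def[abs_def] G_def[abs_def] H_def[abs_def] integral_mult_left by algebra
    moreover have "\<bar>?D\<bar> \<le> \<delta>"
      using defect[OF xy t] by (simp add: goursat_op_def a0_def b0_def d00_def d10_def)
    ultimately show ?thesis
      using \<theta>(3)[OF t] by (auto simp: abs_mult \<theta>0_def intro!: mult_mono)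
  qed
  then have "\<bar>integral {p..q} E\<bar> \<le> \<delta> * B * (q - p)"
    using integral_bound[OF pq cE] by simp
  moreover have "integral {p..q} E = moment \<theta> (x, y) - (integral {p..q} (\<lambda>t. integral {0..y} (\<lambda>r. integral {y..x} (F t r)))
      - (integral {p..q} (\<lambda>t. integral {0..y} (G t)) + y * integral {p..q} (\<lambda>t. integral {y..x} (H t))))"
    unfolding E_def[abs_def] moment_def \<theta>0_def[symmetric]
    by (subst integral_diff integral_add integral_mult_right,
        (intro integrable_continuous_real continuous_intros cIF cIG cIH cw cont xy)+)+ simp
  ultimately show ?thesis unfolding IF IG IH by simp
qed

text \<open>Each application of the integral operator either differentiates \<open>\<theta>\<close>, which costs a factor
  \<open>n + 1\<close> but gains \<open>1 / (k + 1)\<^sup>2\<close> from the double integral, or gains \<open>1 / (k + 1)\<close> without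
  differentiating. Both losses are absorbed by \<open>fact (n + k) / (fact k)\<^sup>2\<close>.\<close>

lemma abs_moment_le:
  assumes "growth_class p q R k n C \<theta>" "0 \<le> C" "(x, y) \<in> Sbar"
  shows "\<bar>moment \<theta> (x, y)\<bar> \<le> C * (defect_const (q - p) A R k n * \<delta>
    + M * (q - p) * (2 * A * (R + 6)) ^ k * (fact (n + k) / (fact k * fact k)) * (x * y) ^ k)"
  using assms
proof (induction k arbitrary: n C \<theta> x y)
  case 0
  have z: "(x, y) \<in> Sbar" by fact
  have "continuous_on {p..q} (\<lambda>t. w ((x, y), t) * fps_nth (\<theta> t) 0)"
    using 0(1) z by (intro continuous_intros continuous_on_w_comp taylor_jet_on_continuous)
      (auto simp: growth_class_def)
  moreover have "\<bar>w ((x, y), t) * fps_nth (\<theta> t) 0\<bar> \<le> M * (C * fact n)" if "t \<in> {p..q}" for t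
    unfolding abs_mult using w_bound[OF z that] growth_class_nth_0[OF 0(1) that] by (intro mult_mono) auto
  ultimately have "\<bar>moment \<theta> (x, y)\<bar> \<le> M * (C * fact n) * (q - p)"
    unfolding moment_def using integral_bound[OF pq, of "\<lambda>t. w ((x, y), t) * fps_nth (\<theta> t) 0"] by simp
  then show ?case by (simp add: mult_ac)
next
  case (Suc k)
  note xy = SbarD[OF Suc.prems(3)]
  define \<alpha> where "\<alpha> n = defect_const (q - p) A R k n * \<delta>" for n
  define \<beta> where "\<beta> n = M * (q - p) * (2 * A * (R + 6)) ^ k * (fact (n + k) / (fact k * fact k))" for n
  have M: "0 \<le> M" using w_bound[OF Suc.prems(3), of p] pq by force
  have \<beta>: "0 \<le> \<beta> n" for n using M pq A R by (simp add: \<beta>_def)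
  define C' where "C' = 2 * A * C"
  have C': "0 \<le> C'" using A Suc.prems(2) by (simp add: C'_def)
  have \<theta>: "taylor_jet_on {p..q} \<theta>" "\<And>t. t \<in> {p, q} \<Longrightarrow> fps_nth (\<theta> t) 0 = 0"
    using Suc.prems(1) unfolding growth_class_def by blast+
  have cb: "\<forall>t\<in>{p..q}. \<forall>j. \<bar>fps_nth (a t) j\<bar> \<le> A * (R / 2) ^ j"
    "\<forall>t\<in>{p..q}. \<forall>j. \<bar>fps_nth (b t) j\<bar> \<le> A * (R / 2) ^ j"
    "\<forall>t\<in>{p..q}. \<forall>j. \<bar>fps_nth (d0 t) j\<bar> \<le> A * (R / 2) ^ j"
    "\<forall>t\<in>{p..q}. \<forall>j. \<bar>fps_nth (d1 t) j\<bar> \<le> A * (R / 2) ^ j"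
    using coeff_bound by blast+
  have coeff: "growth_class p q R (Suc k) n C' (\<lambda>t. u t * \<theta> t)"
    if "taylor_jet_on {p..q} u" "\<forall>t\<in>{p..q}. \<forall>j. \<bar>fps_nth (u t) j\<bar> \<le> A * (R / 2) ^ j" for u
    unfolding C'_def by (rule growth_class_mult[OF that(1) _ Suc.prems(1) A R Suc.prems(2)]) (use that(2) in blast)
  \<comment> \<open>Multiplication by a coefficient keeps \<open>n\<close>, and the surplus order of
    vanishing is simply given up. The differentiated product in \<open>IHa\<close> spends that order
    and passes to \<open>Suc n\<close>.\<close>
  have IH: "\<bar>moment (\<lambda>t. u t * \<theta> t) (s, r)\<bar> \<le> C' * (\<alpha> n + \<beta> n * (s * r) ^ k)"
    if "taylor_jet_on {p..q} u" "\<forall>t\<in>{p..q}. \<forall>j. \<bar>fps_nth (u t) j\<bar> \<le> A * (R / 2) ^ j"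
      "(s, r) \<in> Sbar" for u s r
    unfolding \<alpha>_def \<beta>_def
    by (rule Suc.IH[OF growth_class_mono[OF coeff[OF that(1,2)]] C' that(3)]) auto
  have IHa: "\<bar>moment (\<lambda>t. fps_deriv (a t * \<theta> t)) (s, r)\<bar> \<le> C' * R * (\<alpha> (Suc n) + \<beta> (Suc n) * (s * r) ^ k)"
    if "(s, r) \<in> Sbar" for s r
    unfolding \<alpha>_def \<beta>_def
    by (rule Suc.IH[OF growth_class_deriv[OF coeff[OF jets(1) cb(1)]] _ that]) (use C' R in auto)
  note IHb = IH[OF jets(2) cb(2)] and IHd0 = IH[OF jets(3) cb(3)]
    and IHd1 = IH[OF jets(4) cb(4)]
  have cm: "continuous_on X (\<lambda>v. moment \<phi> (g v))"
    if "taylor_jet_on {p..q} \<phi>" "continuous_on X g" "g ` X \<subseteq> Sbar"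
    for \<phi> X and g :: "'b::topological_space \<Rightarrow> real \<times> real"
    by (rule continuous_on_compose2[OF continuous_on_moment[OF that(1)] that(2,3)])
  note tj = taylor_jet_on_mult[OF jets(1) \<theta>(1)] taylor_jet_on_mult[OF jets(2) \<theta>(1)]
    taylor_jet_on_mult[OF jets(3) \<theta>(1)] taylor_jet_on_mult[OF jets(4) \<theta>(1)]
  define G where "G r s = - moment (\<lambda>t. fps_deriv (a t * \<theta> t)) (s, r)
      + moment (\<lambda>t. d0 t * \<theta> t) (s, r) + (s - r) * moment (\<lambda>t. d1 t * \<theta> t) (s, r)" for r s
  define m where "m = moment (\<lambda>t. b t * \<theta> t)"
  define \<alpha>1 where "\<alpha>1 = C' * (R * \<alpha> (Suc n) + 3 * \<alpha> n)"
  define \<beta>1 where "\<beta>1 = C' * (R * \<beta> (Suc n) + 3 * \<beta> n)"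
  have \<beta>1: "0 \<le> \<beta>1" using C' \<beta> R by (simp add: \<beta>1_def)
  have G: "\<bar>G r s\<bar> \<le> \<alpha>1 + (\<beta>1 * r ^ k) * s ^ k" if r: "r \<in> {0..y}" and s: "s \<in> {y..x}" for r s
  proof -
    have z: "(s, r) \<in> Sbar" using Sbar_rectangle[OF Suc.prems(3) s r] .
    have "\<bar>(s - r) * moment (\<lambda>t. d1 t * \<theta> t) (s, r)\<bar> \<le> 2 * (C' * (\<alpha> n + \<beta> n * (s * r) ^ k))"
      unfolding abs_mult using IHd1[OF z] r s xy by (intro mult_mono) auto
    then have "\<bar>G r s\<bar> \<le> C' * R * (\<alpha> (Suc n) + \<beta> (Suc n) * (s * r) ^ k) + 3 * (C' * (\<alpha> n + \<beta> n * (s * r) ^ k))"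
      unfolding G_def using IHa[OF z] IHd0[OF z] by linarith
    also have "\<dots> = \<alpha>1 + (\<beta>1 * r ^ k) * s ^ k"
      by (simp add: \<alpha>1_def \<beta>1_def algebra_simps)
    finally show ?thesis .
  qed
  have cG: "continuous_on ({0..y} \<times> {y..x}) (\<lambda>(r, s). G r s)"
    unfolding G_def case_prod_beta
    by (intro continuous_intros cm taylor_jet_on_deriv tj)
       (use Sbar_rectangle[OF Suc.prems(3)] in auto)
  have cG1: "continuous_on {y..x} (G r)" if "r \<in> {0..y}" for r
    by (rule continuous_on_compose2[OF cG, of _ "\<lambda>s. (r, s)", simplified])
       (use that in \<open>auto intro!: continuous_intros\<close>)
  have cG2: "continuous_on {0..y} (\<lambda>r. integral {y..x} (G r))"
    using integral_continuous_on_param[of "{0..y}" y x G] cG by simp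
  have IG: "\<bar>integral {0..y} (\<lambda>r. integral {y..x} (G r))\<bar>
      \<le> \<alpha>1 * (x - y) * (y - 0) + \<beta>1 * (x ^ (k + 1) / (k + 1)) * (y ^ (k + 1) / (k + 1))"
  proof (rule abs_integral_le_affine_power[OF _ _ _ cG2])
    fix r assume r: "r \<in> {0..y}"
    have "\<bar>integral {y..x} (G r)\<bar> \<le> \<alpha>1 * (x - y) + (\<beta>1 * r ^ k) * (x ^ (k + 1) / (k + 1))"
      by (rule abs_integral_le_affine_power[OF _ _ _ cG1[OF r]]) (use xy \<beta>1 r G in auto)
    then show "\<bar>integral {y..x} (G r)\<bar> \<le> \<alpha>1 * (x - y) + \<beta>1 * (x ^ (k + 1) / (k + 1)) * r ^ k"
      by (simp add: mult_ac)
  qed (use xy \<beta>1 in auto)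
  have cm1: "continuous_on {0..y} (\<lambda>r. x * m (x, r) - y * m (y, r))"
    and cm2: "continuous_on {y..x} (\<lambda>s. m (s, y))"
    unfolding m_def by (intro continuous_intros cm tj; use Sbar_rectangle[OF Suc.prems(3)] xy in auto)+
  define \<beta>2 where "\<beta>2 = C' * \<beta> n"
  have \<beta>2: "0 \<le> \<beta>2" using C' \<beta> by (simp add: \<beta>2_def)
  have m: "\<bar>m (s, r)\<bar> \<le> C' * \<alpha> n + \<beta>2 * s ^ k * r ^ k" if "(s, r) \<in> Sbar" for s r
    using IHb[OF that] by (simp add: m_def \<beta>2_def algebra_simps)
  have I1: "\<bar>integral {0..y} (\<lambda>r. x * m (x, r) - y * m (y, r))\<bar>
      \<le> (x + y) * (C' * \<alpha> n) * (y - 0) + 2 * \<beta>2 * x ^ (k + 1) * (y ^ (k + 1) / (k + 1))"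
  proof (rule abs_integral_le_affine_power[OF _ _ _ cm1])
    fix r assume r: "r \<in> {0..y}"
    have z: "(x, r) \<in> Sbar" "(y, r) \<in> Sbar" using Sbar_rectangle[OF Suc.prems(3) _ r] xy by auto
    have "\<bar>x * m (x, r) - y * m (y, r)\<bar> \<le> \<bar>x * m (x, r)\<bar> + \<bar>y * m (y, r)\<bar>" by linarith
    also have "\<dots> \<le> x * (C' * \<alpha> n + \<beta>2 * x ^ k * r ^ k) + y * (C' * \<alpha> n + \<beta>2 * y ^ k * r ^ k)"
      unfolding abs_mult using m[OF z(1)] m[OF z(2)] xy by (intro add_mono mult_mono) auto
    also have "\<dots> = (x + y) * (C' * \<alpha> n) + \<beta>2 * (x ^ (k + 1) + y ^ (k + 1)) * r ^ k"
      by (simp add: algebra_simps)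
    \<comment> \<open>Since \<open>y \<le> x\<close>, both endpoint terms are bounded by the same
      power of \<open>x\<close>, hence the factor 2.\<close>
    also have "\<dots> \<le> (x + y) * (C' * \<alpha> n) + \<beta>2 * (x ^ (k + 1) + x ^ (k + 1)) * r ^ k"
      using xy r \<beta>2 by (intro add_mono mult_mono power_mono order_refl) auto
    finally show "\<bar>x * m (x, r) - y * m (y, r)\<bar> \<le> (x + y) * (C' * \<alpha> n) + 2 * \<beta>2 * x ^ (k + 1) * r ^ k"
      by (simp add: algebra_simps)
  qed (use xy \<beta>2 in auto)
  have I2: "\<bar>integral {y..x} (\<lambda>s. m (s, y))\<bar>
      \<le> C' * \<alpha> n * (x - y) + \<beta>2 * y ^ k * (x ^ (k + 1) / (k + 1))"
  proof (rule abs_integral_le_affine_power[OF _ _ _ cm2])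
    fix s assume s: "s \<in> {y..x}"
    then show "\<bar>m (s, y)\<bar> \<le> C' * \<alpha> n + \<beta>2 * y ^ k * s ^ k"
      using m[of s y] Sbar_rectangle[OF Suc.prems(3) s, of y] xy by (simp add: mult_ac)
  qed (use xy \<beta>2 in auto)
  define S where "S = (x * y) ^ (k + 1)"
  have S: "0 \<le> S" "S = x ^ (k + 1) * y ^ (k + 1)" using xy by (auto simp: S_def power_mult_distrib)
  have \<delta>: "0 \<le> \<delta>" using defect[OF Suc.prems(3), of p] pq by force
  have \<alpha>: "0 \<le> \<alpha> n" for n
    using defect_const_nonneg[of "q - p" A R] pq A R \<delta> by (simp add: \<alpha>_def)
  have \<alpha>1: "0 \<le> \<alpha>1" using C' \<alpha> R by (simp add: \<alpha>1_def)
  have T1: "\<bar>integral {0..y} (\<lambda>r. integral {y..x} (G r))\<bar> \<le> \<alpha>1 + \<beta>1 * S / (real k + 1)\<^sup>2"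
  proof -
    have "\<alpha>1 * (x - y) * (y - 0) \<le> \<alpha>1"
      using mult_left_mono[OF xy(8) \<alpha>1] by (simp add: mult_ac)
    then show ?thesis using IG unfolding S(2) by (simp add: power2_eq_square mult_ac add.commute)
  qed
  have T2: "\<bar>integral {0..y} (\<lambda>r. x * m (x, r) - y * m (y, r))\<bar> \<le> 2 * (C' * \<alpha> n) + 2 * \<beta>2 * S / (real k + 1)"
  proof -
    have "(x + y) * y \<le> 2 * 1" using xy by (intro mult_mono) auto
    then have "(C' * \<alpha> n) * ((x + y) * y) \<le> (C' * \<alpha> n) * (2 * 1)"
      using C' \<alpha> by (intro mult_left_mono) auto
    then show ?thesis using I1 unfolding S(2) by (simp add: mult_ac add.commute)
  qed
  have T3: "\<bar>y * integral {y..x} (\<lambda>s. m (s, y))\<bar> \<le> C' * \<alpha> n + \<beta>2 * S / (real k + 1)"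
  proof -
    have "\<bar>y * integral {y..x} (\<lambda>s. m (s, y))\<bar> \<le> y * (C' * \<alpha> n * (x - y) + \<beta>2 * y ^ k * (x ^ (k + 1) / (k + 1)))"
      unfolding abs_mult using I2 xy by (intro mult_mono) auto
    also have "\<dots> = C' * \<alpha> n * ((x - y) * y) + \<beta>2 * S / (real k + 1)"
      unfolding S(2) by (simp add: algebra_simps add_divide_distrib)
    also have "\<dots> \<le> C' * \<alpha> n * 1 + \<beta>2 * S / (real k + 1)"
      using C' \<alpha> xy by (intro add_mono mult_left_mono) auto
    finally show ?thesis by simp
  qed
  have tri: "\<bar>e\<bar> \<le> e' + f' + g' + h'"
    if "\<bar>e - (f - (g + h))\<bar> \<le> e'" "\<bar>f\<bar> \<le> f'" "\<bar>g\<bar> \<le> g'" "\<bar>h\<bar> \<le> h'"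
    for e f g h e' f' g' h' :: real
    using that by linarith
  have "\<bar>moment \<theta> (x, y) - (integral {0..y} (\<lambda>r. integral {y..x} (G r))
      - (integral {0..y} (\<lambda>r. x * m (x, r) - y * m (y, r)) + y * integral {y..x} (\<lambda>s. m (s, y))))\<bar>
      \<le> \<delta> * (C * fact n) * (q - p)"
    using moment_defect[OF \<theta> growth_class_nth_0[OF Suc.prems(1)] Suc.prems(3)] unfolding G_def[abs_def] m_def by simp
  then have "\<bar>moment \<theta> (x, y)\<bar> \<le> \<delta> * (C * fact n) * (q - p) + (\<alpha>1 + \<beta>1 * S / (real k + 1)\<^sup>2)
      + (2 * (C' * \<alpha> n) + 2 * \<beta>2 * S / (real k + 1)) + (C' * \<alpha> n + \<beta>2 * S / (real k + 1))"
    by (rule tri[OF _ T1 T2 T3])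
  also have "\<dots> = C * (defect_const (q - p) A R (Suc k) n * \<delta>)
      + (\<beta>1 / (real k + 1)\<^sup>2 + 3 * \<beta>2 / (real k + 1)) * S"
    by (simp add: \<alpha>1_def C'_def \<alpha>_def algebra_simps)
  also have "\<beta>1 / (real k + 1)\<^sup>2 + 3 * \<beta>2 / (real k + 1) \<le>
      C * (M * (q - p) * (2 * A * (R + 6)) ^ Suc k * (fact (n + Suc k) / (fact (Suc k) * fact (Suc k))))"
  proof -
    \<comment> \<open>\<open>P\<close> is the claimed factor without \<open>C\<close>, one factor
      \<open>2 * A * (R + 6)\<close> and \<open>fact (n + Suc k)\<close>. The differentiated term
      equals \<open>P * fact (n + Suc k)\<close>; the others stay below it since
      \<open>(k + 1) * fact (n + k) \<le> fact (n + Suc k)\<close>. The weights \<open>R\<close>, 3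
      and 3 add up to \<open>R + 6\<close>.\<close>
    define P where "P = M * (q - p) * (2 * A * (R + 6)) ^ k / (fact (Suc k) * fact (Suc k))"
    have P: "0 \<le> P" using M pq A R by (simp add: P_def)
    have f: "fact (Suc k) = (real k + 1) * fact k" by (simp add: add.commute)
    have g: "fact (n + Suc k) = (real n + real k + 1) * fact (n + k)" by (simp add: add_ac)
    have B1: "\<beta> (Suc n) / (real k + 1)\<^sup>2 = P * fact (n + Suc k)"
      unfolding \<beta>_def P_def f by (simp add: field_simps power2_eq_square)
    have b: "\<beta> n / (real k + 1)\<^sup>2 = P * fact (n + k)"
      unfolding \<beta>_def P_def f by (simp add: field_simps power2_eq_square)
    have "real k + 1 \<noteq> 0" by linarith
    then have "\<beta> n / (real k + 1) = (real k + 1) * (\<beta> n / (real k + 1)\<^sup>2)"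
      by (simp add: power2_eq_square)
    then have b': "\<beta> n / (real k + 1) = P * ((real k + 1) * fact (n + k))" by (simp add: b)
    have "P * ((real k + 1) * fact (n + k)) \<le> P * fact (n + Suc k)"
      unfolding g using P by (intro mult_left_mono mult_right_mono) auto
    then have B: "\<beta> n / (real k + 1) \<le> P * fact (n + Suc k)" using b' by simp
    have "P * (1 * fact (n + k)) \<le> P * ((real k + 1) * fact (n + k))"
      using P by (intro mult_left_mono mult_right_mono) auto
    then have B2: "\<beta> n / (real k + 1)\<^sup>2 \<le> P * fact (n + Suc k)" using b' B b by simp
    have "\<beta>1 / (real k + 1)\<^sup>2 + 3 * \<beta>2 / (real k + 1) =
        C' * (R * (\<beta> (Suc n) / (real k + 1)\<^sup>2) + 3 * (\<beta> n / (real k + 1)\<^sup>2) + 3 * (\<beta> n / (real k + 1)))"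
      by (simp add: \<beta>1_def \<beta>2_def add_divide_distrib distrib_left)
    also have "\<dots> \<le> C' * (R * (P * fact (n + Suc k)) + 3 * (P * fact (n + Suc k)) + 3 * (P * fact (n + Suc k)))"
      unfolding B1 using B B2 C' R by (intro mult_left_mono add_mono order_refl) auto
    also have "\<dots> = C * (M * (q - p) * (2 * A * (R + 6)) ^ Suc k * (fact (n + Suc k) / (fact (Suc k) * fact (Suc k))))"
    proof -
      have *: "C' * (R * (P * f) + 3 * (P * f) + 3 * (P * f)) = C * (2 * A * (R + 6) * P * f)" for f
        by (simp add: C'_def algebra_simps)
      show ?thesis unfolding * by (simp add: P_def mult_ac del: fact_Suc)
    qed
    finally show ?thesis .
  qed
  finally show ?case
    using S by (simp add: S_def distrib_left mult_ac mult_right_mono del: fact_Suc defect_const.simps)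
qed

end


section \<open>From moments to pointwise bounds\<close>

text \<open>The Taylor series at \<open>t\<close> of the polynomial
  \<open>1 - ((s - t1) / \<epsilon>)^2\<close> in \<open>s\<close>. Its powers vanish at the ends of
  the window to any prescribed order, and the ratio \<open>1 / \<epsilon>\<close> governing their
  coefficients does not depend on the power.\<close>

definition bump_jet :: "real \<Rightarrow> real \<Rightarrow> real \<Rightarrow> real fps" where
  "bump_jet t1 \<epsilon> t = Abs_fps (\<lambda>j. if j = 0 then 1 - ((t - t1) / \<epsilon>)\<^sup>2
     else if j = 1 then - 2 * ((t - t1) / \<epsilon>) / \<epsilon> else if j = 2 then - 1 / \<epsilon>\<^sup>2 else 0)"

lemma taylor_jet_on_bump_jet:
  assumes "\<epsilon> \<noteq> 0"
  shows "taylor_jet_on J (bump_jet t1 \<epsilon>)"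
  unfolding taylor_jet_on_def
proof (intro ballI allI)
  fix t :: real and j :: nat
  consider "j = 0" | "j = 1" | "j = 2" | "j > 2" by linarith
  then show "((\<lambda>s. fps_nth (bump_jet t1 \<epsilon> s) j) has_real_derivative fps_nth (fps_deriv (bump_jet t1 \<epsilon> t)) j)
      (at t within J)"
    by cases (use assms in \<open>auto simp: bump_jet_def power2_eq_square field_simps intro!: derivative_eq_intros\<close>)
qed

lemma abs_bump_jet_power_le:
  assumes "0 < \<epsilon>" "t \<in> {t1 - \<epsilon>..t1 + \<epsilon>}"
  shows "\<bar>fps_nth (bump_jet t1 \<epsilon> t ^ N) j\<bar> \<le> 4 ^ N * (1 / \<epsilon>) ^ j"
proof (induction N arbitrary: j)
  case 0
  then show ?case using assms by simp
next
  case (Suc N)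
  \<comment> \<open>Bounds for the three coefficients in units of \<open>1 / \<epsilon>\<close>,
    valid because \<open>t\<close> is within \<open>\<epsilon>\<close> of \<open>t1\<close>. Their
    sum 4 is the factor contributed by each multiplication.\<close>
  define c :: "nat \<Rightarrow> real" where "c i = (if i = 0 then 1 else if i = 1 then 2 else if i = 2 then 1 else 0)" for i
  have x: "\<bar>(t - t1) / \<epsilon>\<bar> \<le> 1" using assms by (auto simp: abs_if field_simps)
  have x2: "((t - t1) / \<epsilon>)\<^sup>2 \<le> 1" using abs_square_le_1 x by blast
  have B: "\<bar>fps_nth (bump_jet t1 \<epsilon> t) i\<bar> \<le> c i * (1 / \<epsilon>) ^ i" for i
  proof -
    consider "i = 0" | "i = 1" | "i = 2" | "i > 2" by linarith
    then show ?thesis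
    proof cases
      case 2
      then show ?thesis using x assms(1) by (simp add: bump_jet_def c_def abs_mult field_simps)
    qed (use x2 assms(1) in \<open>simp_all add: bump_jet_def c_def power_divide\<close>)
  qed
  have "\<bar>fps_nth (bump_jet t1 \<epsilon> t ^ Suc N) j\<bar>
      \<le> (\<Sum>i=0..j. \<bar>fps_nth (bump_jet t1 \<epsilon> t) i * fps_nth (bump_jet t1 \<epsilon> t ^ N) (j - i)\<bar>)"
    unfolding power_Suc fps_mult_nth by (rule sum_abs)
  also have "\<dots> \<le> (\<Sum>i=0..j. c i * (4 ^ N * (1 / \<epsilon>) ^ j))"
  proof (rule sum_mono)
    fix i assume i: "i \<in> {0..j}"
    have "\<bar>fps_nth (bump_jet t1 \<epsilon> t) i * fps_nth (bump_jet t1 \<epsilon> t ^ N) (j - i)\<bar>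
        \<le> (c i * (1 / \<epsilon>) ^ i) * (4 ^ N * (1 / \<epsilon>) ^ (j - i))"
      unfolding abs_mult using assms(1) by (intro mult_mono B Suc.IH) (auto simp: c_def)
    also have "\<dots> = c i * (4 ^ N * (1 / \<epsilon>) ^ (i + (j - i)))"
      unfolding power_add by (simp add: mult_ac)
    finally show "\<bar>fps_nth (bump_jet t1 \<epsilon> t) i * fps_nth (bump_jet t1 \<epsilon> t ^ N) (j - i)\<bar>
        \<le> c i * (4 ^ N * (1 / \<epsilon>) ^ j)"
      using i by simp
  qed
  also have "\<dots> = (\<Sum>i=0..j. c i) * (4 ^ N * (1 / \<epsilon>) ^ j)"
    by (simp add: sum_distrib_right)
  also have "\<dots> \<le> 4 * (4 ^ N * (1 / \<epsilon>) ^ j)"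
  proof (rule mult_right_mono)
    \<comment> \<open>The index set is enlarged because \<open>j\<close> may be less than 2.\<close>
    have "sum c {0..j} \<le> sum c ({0..j} \<union> {0, 1, 2})"
      by (rule sum_mono2) (auto simp: c_def)
    also have "\<dots> = sum c {0, 1, 2}"
      by (rule sum.mono_neutral_right) (auto simp: c_def)
    finally show "sum c {0..j} \<le> 4" by (simp add: c_def)
  qed (use assms in auto)
  finally show ?case by simp
qed

lemma growth_class_bump_jet_power:
  assumes "0 < \<epsilon>" "1 / \<epsilon> \<le> R"
  shows "growth_class (t1 - \<epsilon>) (t1 + \<epsilon>) R N 0 (4 ^ N) (\<lambda>t. bump_jet t1 \<epsilon> t ^ N)"
  unfolding growth_class_def
proof (intro conjI ballI allI impI)
  show "taylor_jet_on {t1 - \<epsilon>..t1 + \<epsilon>} (\<lambda>t. bump_jet t1 \<epsilon> t ^ N)"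
    using assms by (intro taylor_jet_on_power taylor_jet_on_bump_jet) auto
next
  fix t j assume "t \<in> {t1 - \<epsilon>..t1 + \<epsilon>}"
  then have "\<bar>fps_nth (bump_jet t1 \<epsilon> t ^ N) j\<bar> \<le> 4 ^ N * (1 / \<epsilon>) ^ j"
    by (rule abs_bump_jet_power_le[OF assms(1)])
  also have "\<dots> \<le> 4 ^ N * R ^ j"
    using assms by (intro mult_left_mono power_mono) auto
  finally show "\<bar>fps_nth (bump_jet t1 \<epsilon> t ^ N) j\<bar> \<le> 4 ^ N * R ^ j * (fact (j + 0) / fact j)"
    by simp
next
  fix t j assume "t \<in> {t1 - \<epsilon>, t1 + \<epsilon>}" "j < N"
  then have "fps_nth (bump_jet t1 \<epsilon> t) 0 = 0" using assms by (auto simp: bump_jet_def)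
  then show "fps_nth (bump_jet t1 \<epsilon> t ^ N) j = 0"
    using startsby_zero_power_prefix \<open>j < N\<close> by blast
qed

lemma bump_jet_power_nth_0: "fps_nth (bump_jet t1 \<epsilon> t ^ N) 0 = (1 - ((t - t1) / \<epsilon>)\<^sup>2) ^ N"
  by (simp add: bump_jet_def fps_nth_power_0)

text \<open>This is the mass by which the moment is divided. It suffices to integrate over the inner
  half of the window, which has length \<open>\<epsilon>\<close> and where the base is at least 1 -
  1 / 4.\<close>

lemma integral_bump_ge:
  fixes t1 \<epsilon> :: real
  assumes "0 < \<epsilon>"
  shows "\<epsilon> * (3 / 4) ^ N \<le> integral {t1 - \<epsilon>..t1 + \<epsilon>} (\<lambda>t. (1 - ((t - t1) / \<epsilon>)\<^sup>2) ^ N)"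
proof -
  let ?f = "\<lambda>t. (1 - ((t - t1) / \<epsilon>)\<^sup>2) ^ N"
  have c: "continuous_on X ?f" for X using assms by (intro continuous_intros) auto
  have sq: "((t - t1) / \<epsilon>)\<^sup>2 \<le> k\<^sup>2" if "\<bar>t - t1\<bar> \<le> k * \<epsilon>" "0 \<le> k" for t k
    using that assms by (intro power2_le_iff_abs_le[THEN iffD2]) (auto simp: abs_if field_simps split: if_splits)
  have nn: "0 \<le> ?f t" if "t \<in> {t1 - \<epsilon>..t1 + \<epsilon>}" for t
    using sq[of t 1] that by (auto simp: abs_if)
  have "\<epsilon> * (3 / 4) ^ N = integral {t1 - \<epsilon> / 2..t1 + \<epsilon> / 2} (\<lambda>_. (3 / 4) ^ N)"
    using assms by simp
  also have "\<dots> \<le> integral {t1 - \<epsilon> / 2..t1 + \<epsilon> / 2} ?f"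
  proof (intro integral_le integrable_continuous_real c continuous_intros)
    fix t assume "t \<in> {t1 - \<epsilon> / 2..t1 + \<epsilon> / 2}"
    then have "((t - t1) / \<epsilon>)\<^sup>2 \<le> (1 / 2)\<^sup>2" by (intro sq) (auto simp: abs_if)
    then show "(3 / 4) ^ N \<le> ?f t" by (intro power_mono) (auto simp: power2_eq_square)
  qed
  also have "\<dots> \<le> integral {t1 - \<epsilon>..t1 + \<epsilon>} ?f"
    by (intro integral_subset_le integrable_continuous_real c) (use assms nn in auto)
  finally show ?thesis .
qed

text \<open>The factor \<open>4 ^ N\<close> bounds the Taylor coefficients of the test function
  \<open>(1 - ((t - t1) / \<epsilon>)\<^sup>2) ^ N\<close>; it is harmless against \<open>fact N\<close>, while letting \<open>N\<close> grow with the
  number of iterations provides the vanishing at the ends of the interval.\<close>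

lemma (in approximate_goursat) abs_midpoint_le:
  assumes \<epsilon>: "0 < \<epsilon>" "p = t1 - \<epsilon>" "q = t1 + \<epsilon>" "1 / \<epsilon> \<le> R"
    and xy: "(x, y) \<in> Sbar"
    and osc: "\<And>t. t \<in> {p..q} \<Longrightarrow> \<bar>w ((x, y), t) - w ((x, y), t1)\<bar> \<le> \<kappa>"
  shows "\<bar>w ((x, y), t1)\<bar> \<le> \<kappa> + (16 / 3) ^ N *
    (defect_const (2 * \<epsilon>) A R N 0 * \<delta> / \<epsilon> + 2 * M * (2 * A * (R + 6)) ^ N / fact N)"
proof -
  let ?f = "\<lambda>t. (1 - ((t - t1) / \<epsilon>)\<^sup>2) ^ N"
  define I where "I = integral {p..q} ?f"
  have I: "\<epsilon> * (3 / 4) ^ N \<le> I" using integral_bump_ge[OF \<epsilon>(1)] by (simp add: I_def \<epsilon>)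
  then have I0: "0 < I" using \<epsilon>(1) by (smt (verit) mult_pos_pos zero_less_power divide_pos_pos)
  have cf: "continuous_on X ?f" for X using \<epsilon>(1) by (intro continuous_intros) auto
  have f: "0 \<le> ?f t" if "t \<in> {p..q}" for t
  proof -
    have "\<bar>(t - t1) / \<epsilon>\<bar> \<le> 1" using that \<epsilon> by (auto simp: abs_if field_simps)
    then have "((t - t1) / \<epsilon>)\<^sup>2 \<le> 1" using abs_square_le_1 by blast
    then show ?thesis by simp
  qed
  have t1: "t1 \<in> {p..q}" using \<epsilon> by auto
  have M: "0 \<le> M" using w_bound[OF xy t1] by linarith
  have cw: "continuous_on {p..q} (\<lambda>t. w ((x, y), t))"
    using xy by (intro continuous_on_w_comp continuous_intros) auto
  define m where "m = moment (\<lambda>t. bump_jet t1 \<epsilon> t ^ N) (x, y)"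
  have m: "m = integral {p..q} (\<lambda>t. w ((x, y), t) * ?f t)"
    by (simp add: m_def moment_def bump_jet_power_nth_0)
  \<comment> \<open>The moment is compared with \<open>w\<close> frozen at the midpoint; by the
    oscillation bound the error is at most \<open>\<kappa> * I\<close>.\<close>
  have "integral {p..q} (\<lambda>t. (w ((x, y), t) - w ((x, y), t1)) * ?f t) = m - w ((x, y), t1) * I"
    unfolding left_diff_distrib m I_def
    by (subst integral_diff, (intro integrable_continuous_real continuous_on_mult continuous_on_const cw cf)+) simp
  moreover have "norm (integral {p..q} (\<lambda>t. (w ((x, y), t) - w ((x, y), t1)) * ?f t))
      \<le> integral {p..q} (\<lambda>t. \<kappa> * ?f t)"
  proof (intro integral_norm_bound_integral integrable_continuous_real continuous_on_mult
      continuous_on_diff continuous_on_const cw cf)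
    fix t assume t: "t \<in> {p..q}"
    show "norm ((w ((x, y), t) - w ((x, y), t1)) * ?f t) \<le> \<kappa> * ?f t"
      unfolding real_norm_def abs_mult abs_of_nonneg[OF f[OF t]]
      using osc[OF t] f[OF t] by (intro mult_right_mono)
  qed
  ultimately have "\<bar>m - w ((x, y), t1) * I\<bar> \<le> \<kappa> * I" by (simp add: I_def)
  then have "\<bar>w ((x, y), t1) * I\<bar> \<le> \<kappa> * I + \<bar>m\<bar>" by linarith
  then have "\<bar>w ((x, y), t1)\<bar> * I \<le> \<kappa> * I + \<bar>m\<bar>" using I0 by (simp add: abs_mult)
  then have 1: "\<bar>w ((x, y), t1)\<bar> \<le> \<kappa> + \<bar>m\<bar> / I" using I0 by (simp add: field_simps)
  define Q where "Q = defect_const (2 * \<epsilon>) A R N 0 * \<delta>"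
  define E where "E = (2 * A * (R + 6)) ^ N / fact N"
  have E: "0 \<le> E" using A R by (simp add: E_def)
  have \<delta>: "0 \<le> \<delta>" using defect[OF xy t1] by linarith
  have Q: "0 \<le> Q" using defect_const_nonneg[of "2 * \<epsilon>" A R] A R \<epsilon> \<delta> by (simp add: Q_def)
  have "growth_class p q R N 0 (4 ^ N) (\<lambda>t. bump_jet t1 \<epsilon> t ^ N)"
    unfolding \<epsilon> using growth_class_bump_jet_power \<epsilon> by blast
  then have "\<bar>m\<bar> \<le> 4 ^ N * (defect_const (q - p) A R N 0 * \<delta>
      + M * (q - p) * (2 * A * (R + 6)) ^ N * (fact (0 + N) / (fact N * fact N)) * (x * y) ^ N)"
    unfolding m_def by (rule abs_moment_le[OF _ _ xy]) simp
  \<comment> \<open>The test function starts with \<open>n = 0\<close>, so the weight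
    \<open>fact (0 + N) / (fact N * fact N)\<close> is \<open>1 / fact N\<close>.\<close>
  also have "\<dots> = 4 ^ N * (Q + M * (2 * \<epsilon>) * E * (x * y) ^ N)"
    by (simp add: \<epsilon> Q_def E_def)
  also have "\<dots> \<le> 4 ^ N * (Q + M * (2 * \<epsilon>) * E * 1)"
    using M \<epsilon> E SbarD[OF xy]
    by (intro mult_left_mono add_left_mono power_le_one) auto
  finally have m': "\<bar>m\<bar> \<le> 4 ^ N * (Q + M * (2 * \<epsilon>) * E)" by simp
  \<comment> \<open>The base 16 / 3 is 4, from the coefficients of the test function, divided by 3 /
    4, from its mass.\<close>
  have "\<bar>m\<bar> / I \<le> (4 ^ N * (Q + M * (2 * \<epsilon>) * E)) / (\<epsilon> * (3 / 4) ^ N)"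
    using m' I \<epsilon> Q M E by (intro frac_le) auto
  also have "\<dots> = (4 ^ N / (3 / 4) ^ N) * ((Q + M * (2 * \<epsilon>) * E) / \<epsilon>)" by simp
  also have "4 ^ N / (3 / 4) ^ N = (16 / 3 :: real) ^ N"
    unfolding power_divide[symmetric] by simp
  also have "(Q + M * (2 * \<epsilon>) * E) / \<epsilon> = Q / \<epsilon> + 2 * M * E"
    using \<epsilon>(1) by (simp add: field_simps)
  finally show ?thesis using 1 by (simp add: Q_def E_def)
qed


section \<open>The kernel equation in integral form\<close>

text \<open>The chain rule along a segment. Only points of the segment have to lie in
  \<open>X\<close>, so it applies on edges and at corners of the domain, even when the parameter set
  shrinks to one point.\<close>

lemma pderiv_in_has_real_derivative:
  assumes "g differentiable_on X" "s \<in> S" "\<And>s. s \<in> S \<Longrightarrow> z + s *\<^sub>R v \<in> X"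
  shows "((\<lambda>s. g (z + s *\<^sub>R v)) has_real_derivative pderiv_in X v g (z + s *\<^sub>R v)) (at s within S)"
proof -
  have "((\<lambda>s. z + s *\<^sub>R v) has_vector_derivative v) (at s within S)"
    by (auto intro!: derivative_eq_intros)
  moreover have "(g has_derivative frechet_derivative g (at (z + s *\<^sub>R v) within X)) (at (z + s *\<^sub>R v) within X)"
    using assms by (auto simp: differentiable_on_def frechet_derivative_works[symmetric])
  then have "(g has_derivative frechet_derivative g (at (z + s *\<^sub>R v) within X))
      (at (z + s *\<^sub>R v) within (\<lambda>s. z + s *\<^sub>R v) ` S)"
    by (rule has_derivative_subset) (use assms(3) in auto)
  ultimately have "((g \<circ> (\<lambda>s. z + s *\<^sub>R v)) has_vector_derivative
      frechet_derivative g (at (z + s *\<^sub>R v) within X) v) (at s within S)"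
    by (rule vector_derivative_diff_chain_within)
  then show ?thesis
    by (simp add: o_def pderiv_in_def has_real_derivative_iff_has_vector_derivative)
qed

text \<open>The two integrations by parts turn \<open>e\<close> into \<open>e + 2 * b\<close>, which explains the last summand of
  \<open>coeff_d0\<close> below.\<close>

lemma goursat_integral_identity:
  fixes u us ur usr ut :: "real \<times> real \<Rightarrow> real"
  assumes xy: "(x, y) \<in> Sbar"
    and cont: "continuous_on Sbar u" "continuous_on Sbar us" "continuous_on Sbar ur"
      "continuous_on Sbar usr" "continuous_on Sbar ut"
    and du: "\<And>s r. s \<in> {y..x} \<Longrightarrow> r \<in> {0..y} \<Longrightarrow>
        ((\<lambda>s. u (s, r)) has_real_derivative us (s, r)) (at s within {y..x})"
      "\<And>s r. s \<in> {y..x} \<Longrightarrow> r \<in> {0..y} \<Longrightarrow>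
        ((\<lambda>r. u (s, r)) has_real_derivative ur (s, r)) (at r within {0..y})"
      "\<And>s r. s \<in> {y..x} \<Longrightarrow> r \<in> {0..y} \<Longrightarrow>
        ((\<lambda>s. ur (s, r)) has_real_derivative usr (s, r)) (at s within {y..x})"
    and eq: "\<And>s r. s \<in> {y..x} \<Longrightarrow> r \<in> {0..y} \<Longrightarrow>
        usr (s, r) = a * ut (s, r) - b * (s * us (s, r) + r * ur (s, r)) + (e + (s - r) * d1) * u (s, r)"
  shows "u (x, y) = u (x, 0) + u (y, y) - u (y, 0) + goursat_op a b (e + 2 * b) d1 u ut x y"
proof -
  note xy' = SbarD[OF xy]
  have sub: "{y..x} \<times> {0..y} \<subseteq> Sbar" using Sbar_rectangle[OF xy] by auto
  have comp: "continuous_on X (\<lambda>v. h (g v))"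
    if "h \<in> {u, us, ur, usr, ut}" "continuous_on X g" "g ` X \<subseteq> Sbar"
    for h X and g :: "'b::topological_space \<Rightarrow> real \<times> real"
    using that cont continuous_on_compose2[OF _ that(2,3)] by auto
  have FTC: "integral {c..d} h' = h d - h c"
    if "c \<le> d" "\<And>v. v \<in> {c..d} \<Longrightarrow> (h has_real_derivative h' v) (at v within {c..d})" for c d and h h' :: "real \<Rightarrow> real"
    by (rule integral_unique[OF fundamental_theorem_of_calculus])
       (use that in \<open>auto simp: has_real_derivative_iff_has_vector_derivative\<close>)
  have int1: "h integrable_on {c..d}" if "continuous_on {c..d} h" for c d and h :: "real \<Rightarrow> real"
    using that by (rule integrable_continuous_real)
  have ci: "continuous_on {0..y} (\<lambda>r. integral {y..x} (\<lambda>s. h r s))"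
    if "continuous_on ({0..y} \<times> {y..x}) (\<lambda>(r, s). h r s)" for h :: "real \<Rightarrow> real \<Rightarrow> real"
    using integral_continuous_on_param[of "{0..y}" y x h] that by simp
  have swap: "integral {0..y} (\<lambda>r. integral {y..x} (\<lambda>s. h r s)) = integral {y..x} (\<lambda>s. integral {0..y} (\<lambda>r. h r s))"
    if "continuous_on ({0..y} \<times> {y..x}) (\<lambda>(r, s). h r s)" for h :: "real \<Rightarrow> real \<Rightarrow> real"
    using integral_swap_continuous[of 0 y y x h] that by (simp add: cbox_Pair_eq)
  define J where "J h = integral {0..y} (\<lambda>r. integral {y..x} (\<lambda>s. h r s))" for h :: "real \<Rightarrow> real \<Rightarrow> real"
  have Jadd: "J (\<lambda>r s. h r s + k r s) = J h + J k"
    if "continuous_on ({0..y} \<times> {y..x}) (\<lambda>(r, s). h r s)" "continuous_on ({0..y} \<times> {y..x}) (\<lambda>(r, s). k r s)"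
    for h k :: "real \<Rightarrow> real \<Rightarrow> real"
  proof -
    have "continuous_on {y..x} (h r)" "continuous_on {y..x} (k r)" if "r \<in> {0..y}" for r
      using that by (auto intro!: continuous_intros
          continuous_on_compose2[OF \<open>continuous_on _ (\<lambda>(r, s). h r s)\<close>, of _ "\<lambda>s. (r, s)", simplified]
          continuous_on_compose2[OF \<open>continuous_on _ (\<lambda>(r, s). k r s)\<close>, of _ "\<lambda>s. (r, s)", simplified])
    then have "J (\<lambda>r s. h r s + k r s) = integral {0..y} (\<lambda>r. integral {y..x} (h r) + integral {y..x} (k r))"
      unfolding J_def by (intro integral_cong integral_add int1) auto
    also have "\<dots> = J h + J k"
      unfolding J_def by (intro integral_add int1 ci that)
    finally show ?thesis .
  qed
  have Jmult: "J (\<lambda>r s. c * h r s) = c * J h" for c h by (simp add: J_def)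
  have Jcong: "J h = J k" if "\<And>r s. r \<in> {0..y} \<Longrightarrow> s \<in> {y..x} \<Longrightarrow> h r s = k r s" for h k
    unfolding J_def using that by (intro integral_cong) auto
  have c2: "continuous_on ({0..y} \<times> {y..x}) (\<lambda>v. u (snd v, fst v))"
    "continuous_on ({0..y} \<times> {y..x}) (\<lambda>v. us (snd v, fst v))"
    "continuous_on ({0..y} \<times> {y..x}) (\<lambda>v. ur (snd v, fst v))"
    "continuous_on ({0..y} \<times> {y..x}) (\<lambda>v. ut (snd v, fst v))"
    by (intro comp continuous_intros; use sub in auto)+
  have cI: "continuous_on {0..y} (\<lambda>r. u (s, r))" "continuous_on {0..y} (\<lambda>r. ur (s, r))" if "s \<in> {y..x}" for s
    by (intro comp continuous_intros; use sub that in auto)+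
  have cI': "continuous_on {y..x} (\<lambda>s. u (s, r))" "continuous_on {y..x} (\<lambda>s. us (s, r))" if "r \<in> {0..y}" for r
    by (intro comp continuous_intros; use sub that in auto)+
  \<comment> \<open>Two applications of the fundamental theorem leave the four corner values of the
    rectangle; all but \<open>u (x, y)\<close> lie on the part of the boundary with prescribed
    data.\<close>
  have "J (\<lambda>r s. usr (s, r)) = integral {0..y} (\<lambda>r. ur (x, r) - ur (y, r))"
    unfolding J_def by (intro integral_cong FTC[of y x "\<lambda>s. ur (s, r)" "\<lambda>s. usr (s, r)" for r] du) (use xy' in auto)
  also have "\<dots> = integral {0..y} (\<lambda>r. ur (x, r)) - integral {0..y} (\<lambda>r. ur (y, r))"
    by (intro integral_diff int1 cI) (use xy' in auto)
  also have "\<dots> = (u (x, y) - u (x, 0)) - (u (y, y) - u (y, 0))"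
    using FTC[of 0 y "\<lambda>r. u (x, r)" "\<lambda>r. ur (x, r)"] FTC[of 0 y "\<lambda>r. u (y, r)" "\<lambda>r. ur (y, r)"]
      du(2) xy' by simp
  finally have 1: "J (\<lambda>r s. usr (s, r)) = u (x, y) - u (x, 0) - u (y, y) + u (y, 0)" by simp
  have "J (\<lambda>r s. s * us (s, r)) + J (\<lambda>r s. u (s, r)) = J (\<lambda>r s. s * us (s, r) + u (s, r))"
    by (rule Jadd[symmetric]) (unfold case_prod_beta, (intro continuous_intros c2)+)
  also have "\<dots> = integral {0..y} (\<lambda>r. x * u (x, r) - y * u (y, r))"
    unfolding J_def
    by (intro integral_cong FTC[of y x "\<lambda>s. s * u (s, r)" "\<lambda>s. s * us (s, r) + u (s, r)" for r])
       (use xy' du(1) in \<open>auto intro!: derivative_eq_intros\<close>)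
  finally have 2: "J (\<lambda>r s. s * us (s, r)) = integral {0..y} (\<lambda>r. x * u (x, r) - y * u (y, r)) - J (\<lambda>r s. u (s, r))"
    by simp
  have "J (\<lambda>r s. r * ur (s, r)) + J (\<lambda>r s. u (s, r)) = J (\<lambda>r s. r * ur (s, r) + u (s, r))"
    by (rule Jadd[symmetric]) (unfold case_prod_beta, (intro continuous_intros c2)+)
  \<comment> \<open>The integral over \<open>r\<close> has to be the inner one for the integration
    by parts.\<close>
  also have "\<dots> = integral {y..x} (\<lambda>s. integral {0..y} (\<lambda>r. r * ur (s, r) + u (s, r)))"
    unfolding J_def
    by (rule swap) (unfold case_prod_beta, (intro continuous_intros c2)+)
  also have "\<dots> = integral {y..x} (\<lambda>s. y * u (s, y) - 0 * u (s, 0))"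
    by (intro integral_cong FTC[of 0 y "\<lambda>r. r * u (s, r)" "\<lambda>r. r * ur (s, r) + u (s, r)" for s])
       (use xy' du(2) in \<open>auto intro!: derivative_eq_intros\<close>)
  finally have 3: "J (\<lambda>r s. r * ur (s, r)) = y * integral {y..x} (\<lambda>s. u (s, y)) - J (\<lambda>r s. u (s, r))"
    by simp
  define F where "F r s = a * ut (s, r) + (e + (s - r) * d1) * u (s, r)" for r s
  define G where "G r s = s * us (s, r) + r * ur (s, r)" for r s
  have cFG: "continuous_on ({0..y} \<times> {y..x}) (\<lambda>(r, s). F r s)"
    "continuous_on ({0..y} \<times> {y..x}) (\<lambda>(r, s). - b * G r s)"
    "continuous_on ({0..y} \<times> {y..x}) (\<lambda>(r, s). 2 * b * u (s, r))"
    unfolding F_def G_def case_prod_beta by (intro continuous_intros c2)+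
  have "J (\<lambda>r s. a * ut (s, r) + ((e + 2 * b) + (s - r) * d1) * u (s, r)) = J (\<lambda>r s. F r s + 2 * b * u (s, r))"
    by (simp add: F_def algebra_simps)
  also have "\<dots> = J F + 2 * b * J (\<lambda>r s. u (s, r))"
    using Jadd[OF cFG(1,3)] by (simp only: Jmult)
  finally have 4: "J (\<lambda>r s. a * ut (s, r) + ((e + 2 * b) + (s - r) * d1) * u (s, r)) = \<dots>" .
  have "J G = J (\<lambda>r s. s * us (s, r)) + J (\<lambda>r s. r * ur (s, r))"
    unfolding G_def
    by (rule Jadd) (unfold case_prod_beta, (intro continuous_intros c2)+)
  note 5 = this[unfolded 2 3]
  have "J (\<lambda>r s. usr (s, r)) = J (\<lambda>r s. F r s + (- b) * G r s)"
    using eq by (intro Jcong) (simp add: F_def G_def)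
  also have "\<dots> = J F + (- b) * J G"
    using Jadd[OF cFG(1,2)] by (simp only: Jmult)
  finally have "J (\<lambda>r s. usr (s, r)) = J (\<lambda>r s. a * ut (s, r) + ((e + 2 * b) + (s - r) * d1) * u (s, r))
      - b * (integral {0..y} (\<lambda>r. x * u (x, r) - y * u (y, r)) + y * integral {y..x} (\<lambda>s. u (s, y)))"
    unfolding 4 5 by (simp add: algebra_simps)
  then show ?thesis
    unfolding 1 by (simp add: goursat_op_def J_def)
qed

lemma Cn_on_2D:
  assumes "Cn_on 2 X g" "v \<in> Basis" "v' \<in> Basis"
  shows "g differentiable_on X" "pderiv_in X v g differentiable_on X"
    "continuous_on X g" "continuous_on X (pderiv_in X v g)" "continuous_on X (pderiv_in X v' (pderiv_in X v g))"
  using assms by (auto simp: numeral_2_eq_2 intro: differentiable_imp_continuous_on)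

lemma spacetime_Basis:
  "((1, 0), 0) \<in> (Basis :: ((real \<times> real) \<times> real) set)"
  "((0, 1), 0) \<in> (Basis :: ((real \<times> real) \<times> real) set)"
  "((0, 0), 1) \<in> (Basis :: ((real \<times> real) \<times> real) set)"
  by (auto simp: Basis_prod_def zero_prod_def)

text \<open>Once the kernel equation is multiplied by \<open>l^2 / (4 * \<alpha>)\<close>, the
  quotient \<open>l' / l\<close> disappears and all coefficients are polynomials in
  \<open>l\<close>, \<open>l'\<close>, \<open>l''\<close>. Written as functions of this triple they
  are visibly continuous, and the comparison in the \<open>C^2\<close> distance reduces to uniform
  continuity.\<close>

definition coeff_a :: "real \<Rightarrow> real \<times> real \<times> real \<Rightarrow> real" where
  "coeff_a \<alpha> = (\<lambda>(p, p', p''). p * p / (4 * \<alpha>))"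

definition coeff_b :: "real \<Rightarrow> real \<times> real \<times> real \<Rightarrow> real" where
  "coeff_b \<alpha> = (\<lambda>(p, p', p''). p * p' / (4 * \<alpha>))"

definition coeff_d0 :: "real \<Rightarrow> real \<Rightarrow> real \<times> real \<times> real \<Rightarrow> real" where
  "coeff_d0 \<alpha> \<kappa> = (\<lambda>(p, p', p''). p * p / (4 * \<alpha>) * (\<kappa> - p' * p' / (4 * \<alpha>)) + 2 * (p * p' / (4 * \<alpha>)))"

definition coeff_d1 :: "real \<Rightarrow> real \<times> real \<times> real \<Rightarrow> real" where
  "coeff_d1 \<alpha> = (\<lambda>(p, p', p''). - (p * p / (4 * \<alpha>) * (p * p'' / (4 * \<alpha>))))"

definition coeff_f1 :: "real \<Rightarrow> real \<Rightarrow> real \<times> real \<times> real \<Rightarrow> real" where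
  "coeff_f1 \<alpha> \<kappa> = (\<lambda>(p, p', p''). p / (4 * \<alpha>) * (2 * p' * p' / (8 * \<alpha>) - \<kappa>))"

definition coeff_f2 :: "real \<Rightarrow> real \<times> real \<times> real \<Rightarrow> real" where
  "coeff_f2 \<alpha> = (\<lambda>(p, p', p''). p / (4 * \<alpha>) * (p * p'' / (8 * \<alpha>)))"

definition jet2 :: "real \<Rightarrow> real \<Rightarrow> (real \<Rightarrow> real) \<Rightarrow> real \<Rightarrow> real \<times> real \<times> real" where
  "jet2 t0 T l t = (l t, tderiv t0 T 1 l t, tderiv t0 T 2 l t)"

lemma f_bdry_eq:
  "f_bdry t0 T \<alpha> lam0 c l \<xi> t =
    \<xi> * coeff_f1 \<alpha> (lam0 + c) (jet2 t0 T l t) + \<xi>\<^sup>2 * coeff_f2 \<alpha> (jet2 t0 T l t)"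
  by (simp add: f_bdry_def coeff_f1_def coeff_f2_def jet2_def power2_eq_square algebra_simps
      add_divide_distrib diff_divide_distrib)

lemma kernel_continuous:
  assumes "solves_kernel_eq t0 T \<alpha> lam0 c l K"
  shows "continuous_on (Kdom t0 T) K" "continuous_on (Kdom t0 T) (d_t t0 T K)"
proof -
  have "Cn_on 2 (Kdom t0 T) K" using assms by (simp add: solves_kernel_eq_def)
  from Cn_on_2D(3,4)[OF this spacetime_Basis(3,3)]
  show "continuous_on (Kdom t0 T) K" "continuous_on (Kdom t0 T) (d_t t0 T K)" .
qed

lemma kernel_has_time_derivative:
  assumes "solves_kernel_eq t0 T \<alpha> lam0 c l K" "z \<in> Sbar" "S \<subseteq> {t0..T}" "t \<in> S"
  shows "((\<lambda>t. K (z, t)) has_real_derivative d_t t0 T K (z, t)) (at t within S)"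
proof -
  have "K differentiable_on Kdom t0 T"
    using assms Cn_on_2D(1)[OF _ spacetime_Basis(3,3)] by (simp add: solves_kernel_eq_def)
  moreover have "(z, 0) + s *\<^sub>R ((0, 0), 1) \<in> Kdom t0 T" if "s \<in> S" for s
    using assms(2,3) that by (auto simp: Kdom_def zero_prod_def[symmetric])
  ultimately show ?thesis
    using pderiv_in_has_real_derivative[of K "Kdom t0 T" t S "(z, 0)" "((0, 0), 1)"] assms(4)
    by (simp add: zero_prod_def[symmetric])
qed

lemma kernel_integral_identity:
  assumes K: "solves_kernel_eq t0 T \<alpha> lam0 c l K"
    and "0 < \<alpha>" "0 < l t" "t \<in> {t0..T}" and xy: "(x, y) \<in> Sbar"
  defines "P \<equiv> jet2 t0 T l t"
  shows "K ((x, y), t) = f_bdry t0 T \<alpha> lam0 c l x t - f_bdry t0 T \<alpha> lam0 c l y t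
    + goursat_op (coeff_a \<alpha> P) (coeff_b \<alpha> P) (coeff_d0 \<alpha> (lam0 + c) P) (coeff_d1 \<alpha> P)
        (\<lambda>z. K (z, t)) (\<lambda>z. d_t t0 T K (z, t)) x y"
proof -
  have C: "Cn_on 2 (Kdom t0 T) K" using K by (simp add: solves_kernel_eq_def)
  note xy' = SbarD[OF xy]
  have sub: "(s, r) \<in> Sbar" if "s \<in> {y..x}" "r \<in> {0..y}" for s r
    using Sbar_rectangle[OF xy that] .
  note B = spacetime_Basis
  note C1 = Cn_on_2D[OF C B(1) B(1)] and C2 = Cn_on_2D[OF C B(2) B(1)] and C3 = Cn_on_2D[OF C B(3) B(1)]
  have slice: "continuous_on Sbar (\<lambda>z. h (z, t))" if "continuous_on (Kdom t0 T) h" for h :: "_ \<Rightarrow> real"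
    by (rule continuous_on_compose2[OF that])
       (use assms(4) in \<open>auto simp: Kdom_def intro!: continuous_intros\<close>)
  define a where "a = coeff_a \<alpha> P"
  define b where "b = coeff_b \<alpha> P"
  \<comment> \<open>\<open>goursat_integral_identity\<close> adds \<open>2 * b\<close> to the
    coefficient it is given, so this much is subtracted beforehand.\<close>
  define e where "e = coeff_d0 \<alpha> (lam0 + c) P - 2 * b"
  define d1 where "d1 = coeff_d1 \<alpha> P"
  have "K ((x, y), t) = K ((x, 0), t) + K ((y, y), t) - K ((y, 0), t)
      + goursat_op a b (e + 2 * b) d1 (\<lambda>z. K (z, t)) (\<lambda>z. d_t t0 T K (z, t)) x y"
  proof (rule goursat_integral_identity[OF xy, where us = "\<lambda>z. d_xi t0 T K (z, t)"
        and ur = "\<lambda>z. d_eta t0 T K (z, t)" and usr = "\<lambda>z. d_xi t0 T (d_eta t0 T K) (z, t)"])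
    show "continuous_on Sbar (\<lambda>z. K (z, t))" "continuous_on Sbar (\<lambda>z. d_xi t0 T K (z, t))"
      "continuous_on Sbar (\<lambda>z. d_eta t0 T K (z, t))"
      "continuous_on Sbar (\<lambda>z. d_xi t0 T (d_eta t0 T K) (z, t))"
      "continuous_on Sbar (\<lambda>z. d_t t0 T K (z, t))"
      by (intro slice C1 C2 C3)+
  next
    fix s r assume s: "s \<in> {y..x}" and r: "r \<in> {0..y}"
    show "((\<lambda>s. K ((s, r), t)) has_real_derivative d_xi t0 T K ((s, r), t)) (at s within {y..x})"
      using pderiv_in_has_real_derivative[OF C1(1) s, of "((0, r), t)" "((1, 0), 0)"] sub r assms(4)
      by (auto simp: Kdom_def)
    show "((\<lambda>r. K ((s, r), t)) has_real_derivative d_eta t0 T K ((s, r), t)) (at r within {0..y})"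
      using pderiv_in_has_real_derivative[OF C1(1) r, of "((s, 0), t)" "((0, 1), 0)"] sub s assms(4)
      by (auto simp: Kdom_def)
    show "((\<lambda>s. d_eta t0 T K ((s, r), t)) has_real_derivative d_xi t0 T (d_eta t0 T K) ((s, r), t))
        (at s within {y..x})"
      using pderiv_in_has_real_derivative[OF C2(2) s, of "((0, r), t)" "((1, 0), 0)"] sub r assms(4)
      by (auto simp: Kdom_def)
    define k kt ks kr ksr where "k = K ((s, r), t)" and "kt = d_t t0 T K ((s, r), t)"
      and "ks = d_xi t0 T K ((s, r), t)" and "kr = d_eta t0 T K ((s, r), t)"
      and "ksr = d_xi t0 T (d_eta t0 T K) ((s, r), t)"
    define m m' m'' where "m = l t" and "m' = tderiv t0 T 1 l t" and "m'' = tderiv t0 T 2 l t"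
    have m: "m > 0" using assms(3) by (simp add: m_def)
    have "kt = 4 * \<alpha> / m\<^sup>2 * ksr + m' / m * (s * ks + r * kr) - lambda_bar t0 T \<alpha> lam0 c l s r t * k"
      using K sub[OF s r] assms(4)
      unfolding solves_kernel_eq_def k_def kt_def ks_def kr_def ksr_def m_def m'_def by blast
    \<comment> \<open>Multiplication by \<open>m\<^sup>2 / (4 * \<alpha>)\<close> isolates the mixed
      derivative \<open>ksr\<close>; positivity of \<open>m\<close> is what allows the
      cancellation.\<close>
    then have "m\<^sup>2 / (4 * \<alpha>) * kt = m\<^sup>2 / (4 * \<alpha>) * (4 * \<alpha> / m\<^sup>2 * ksr)
        + m\<^sup>2 / (4 * \<alpha>) * (m' / m * (s * ks + r * kr)) - m\<^sup>2 / (4 * \<alpha>) * (lambda_bar t0 T \<alpha> lam0 c l s r t * k)"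
      by (simp only: distrib_left right_diff_distrib)
    moreover have "m\<^sup>2 / (4 * \<alpha>) * (4 * \<alpha> / m\<^sup>2 * z) = z"
      "m\<^sup>2 / (4 * \<alpha>) * (m' / m * z) = m * m' / (4 * \<alpha>) * z" for z
      using m assms(2) by (simp_all add: power2_eq_square)
    ultimately have "m\<^sup>2 / (4 * \<alpha>) * kt = ksr + m * m' / (4 * \<alpha>) * (s * ks + r * kr)
        - m\<^sup>2 / (4 * \<alpha>) * lambda_bar t0 T \<alpha> lam0 c l s r t * k"
      by simp
    then have "ksr = a * kt - b * (s * ks + r * kr) + (m\<^sup>2 / (4 * \<alpha>) * lambda_bar t0 T \<alpha> lam0 c l s r t) * k"
      by (simp add: a_def b_def coeff_a_def coeff_b_def P_def jet2_def m_def m'_def power2_eq_square)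
    moreover have "m\<^sup>2 / (4 * \<alpha>) * lambda_bar t0 T \<alpha> lam0 c l s r t = e + (s - r) * d1"
      by (simp add: lambda_bar_def e_def b_def d1_def coeff_d0_def coeff_b_def coeff_d1_def P_def jet2_def
          m_def[symmetric] m'_def[symmetric, simplified] m''_def[symmetric] power2_eq_square
          algebra_simps add_divide_distrib diff_divide_distrib)
    ultimately have "ksr = a * kt - b * (s * ks + r * kr) + (e + (s - r) * d1) * k"
      by (simp only:)
    then show "d_xi t0 T (d_eta t0 T K) ((s, r), t) = a * d_t t0 T K ((s, r), t)
        - b * (s * d_xi t0 T K ((s, r), t) + r * d_eta t0 T K ((s, r), t)) + (e + (s - r) * d1) * K ((s, r), t)"
      by (simp add: k_def kt_def ks_def kr_def ksr_def)
  qed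
  moreover have "K ((y, y), t) = 0" "K ((x, 0), t) = f_bdry t0 T \<alpha> lam0 c l x t"
    "K ((y, 0), t) = f_bdry t0 T \<alpha> lam0 c l y t"
  proof -
    have "(y, y) \<in> Sbar" "(x, 0) \<in> Sbar" "(y, 0) \<in> Sbar" using xy' by (auto simp: Sbar_def)
    then show "K ((y, y), t) = 0" "K ((x, 0), t) = f_bdry t0 T \<alpha> lam0 c l x t"
      "K ((y, 0), t) = f_bdry t0 T \<alpha> lam0 c l y t"
      using K assms(4) unfolding solves_kernel_eq_def by blast+
  qed
  ultimately show ?thesis by (simp add: a_def b_def e_def d1_def)
qed


section \<open>Dependence of the coefficients on the moving boundary\<close>

definition taylor_jet :: "real \<Rightarrow> real \<Rightarrow> (real \<Rightarrow> real) \<Rightarrow> real \<Rightarrow> real fps" where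
  "taylor_jet t0 T l t = Abs_fps (\<lambda>j. tderiv t0 T j l t / fact j)"

text \<open>Divided by the factorial, the derivative bound is geometric growth. It is available for
  \<open>t > t0\<close> only, hence the half-open interval; the time windows will stay away from
  \<open>t0\<close>.\<close>

lemma analytic_jet_on_taylor_jet:
  assumes "t0 < T" "real_analytic_Icc t0 T l" "factorial_derivative_bound t0 T l"
  shows "analytic_jet_on {t0<..T} (taylor_jet t0 T l)"
proof -
  have "taylor_jet_on {t0..T} (taylor_jet t0 T l)"
    unfolding taylor_jet_on_def
  proof (intro ballI allI)
    fix t j assume t: "t \<in> {t0..T}"
    have "(tderiv t0 T j l has_real_derivative tderiv t0 T (Suc j) l t) (at t within {t0..T})"
      using real_analytic_Icc_derivative(1)[OF assms(1) real_analytic_Icc_tderiv[OF assms(1,2)] t]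
      by (simp add: has_real_derivative_iff_has_vector_derivative)
    then have "((\<lambda>t. tderiv t0 T j l t / fact j) has_real_derivative tderiv t0 T (Suc j) l t / fact j)
        (at t within {t0..T})"
      by (rule DERIV_cdivide)
    moreover have "fps_nth (fps_deriv (taylor_jet t0 T l t)) j = tderiv t0 T (Suc j) l t / fact j"
    proof -
      have "fact (Suc j) = (1 + real j) * fact j" by simp
      moreover have "1 + real j \<noteq> 0" by linarith
      ultimately show ?thesis by (simp add: taylor_jet_def del: fact_Suc tderiv.simps)
    qed
    ultimately show "((\<lambda>s. fps_nth (taylor_jet t0 T l s) j) has_real_derivative
        fps_nth (fps_deriv (taylor_jet t0 T l t)) j) (at t within {t0..T})"
      by (simp only:) (simp add: taylor_jet_def)
  qed
  then have "taylor_jet_on {t0<..T} (taylor_jet t0 T l)"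
    by (rule taylor_jet_on_subset) auto
  moreover obtain D where D: "\<And>t j. t \<in> {t0<..T} \<Longrightarrow> \<bar>tderiv t0 T j l t\<bar> \<le> D ^ (j + 1) * fact j"
    using assms(3) unfolding factorial_derivative_bound_def by blast
  have "geometrically_bounded_on {t0<..T} (taylor_jet t0 T l)"
    unfolding geometrically_bounded_on_def
  proof (intro exI ballI allI)
    fix t j assume "t \<in> {t0<..T}"
    then show "\<bar>fps_nth (taylor_jet t0 T l t) j\<bar> \<le> D * D ^ j"
      using D[of t j] by (simp add: taylor_jet_def abs_divide divide_le_eq)
  qed
  ultimately show ?thesis by (simp add: analytic_jet_on_def)
qed

text \<open>Being polynomials in \<open>l\<close>, \<open>l'\<close>, \<open>l''\<close>, the
  coefficients lift to the jet of \<open>l\<close> and its formal derivatives by the closure rules.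
  Signs become multiplications by \<open>fps_const (-1)\<close>, which these rules cover.\<close>

lemma coefficient_jets:
  assumes "t0 < T" "real_analytic_Icc t0 T l" "factorial_derivative_bound t0 T l"
  obtains a b d0 d1 where
    "analytic_jet_on {t0<..T} a" "\<And>t. fps_nth (a t) 0 = coeff_a \<alpha> (jet2 t0 T l t)"
    "analytic_jet_on {t0<..T} b" "\<And>t. fps_nth (b t) 0 = coeff_b \<alpha> (jet2 t0 T l t)"
    "analytic_jet_on {t0<..T} d0" "\<And>t. fps_nth (d0 t) 0 = coeff_d0 \<alpha> \<kappa> (jet2 t0 T l t)"
    "analytic_jet_on {t0<..T} d1" "\<And>t. fps_nth (d1 t) 0 = coeff_d1 \<alpha> (jet2 t0 T l t)"
proof -
  define L where "L = taylor_jet t0 T l"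
  have L: "analytic_jet_on {t0<..T} L" unfolding L_def by (rule analytic_jet_on_taylor_jet[OF assms])
  have L': "analytic_jet_on {t0<..T} (\<lambda>t. L t)" using L by simp
  have nth: "fps_nth (L t) 0 = l t" "fps_nth (fps_deriv (L t)) 0 = tderiv t0 T 1 l t"
    "fps_nth (fps_deriv (fps_deriv (L t))) 0 = tderiv t0 T 2 l t" for t
    by (simp_all add: L_def taylor_jet_def numeral_2_eq_2 del: tderiv.simps(2))
  define k where "k = fps_const (1 / (4 * \<alpha>))"
  define a where "a t = k * (L t * L t)" for t
  define b where "b t = k * (L t * fps_deriv (L t))" for t
  define d0 where "d0 t = a t * (fps_const \<kappa> + fps_const (-1) * (k * (fps_deriv (L t) * fps_deriv (L t))))
    + fps_const 2 * b t" for t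
  define d1 where "d1 t = fps_const (-1) * (a t * (k * (L t * fps_deriv (fps_deriv (L t)))))" for t
  note intros = analytic_jet_on_mult analytic_jet_on_add analytic_jet_on_const analytic_jet_on_deriv L'
  have a: "analytic_jet_on {t0<..T} (\<lambda>t. a t)" and b: "analytic_jet_on {t0<..T} (\<lambda>t. b t)"
    unfolding a_def b_def k_def by (intro intros)+
  have d: "analytic_jet_on {t0<..T} d0" "analytic_jet_on {t0<..T} d1"
    unfolding d0_def[abs_def] d1_def[abs_def] k_def by (intro intros a b)+
  show ?thesis
  proof (rule that)
    show "analytic_jet_on {t0<..T} a" "analytic_jet_on {t0<..T} b" "analytic_jet_on {t0<..T} d0"
      "analytic_jet_on {t0<..T} d1" using a b d by auto
  qed (simp_all add: a_def b_def d0_def d1_def k_def nth jet2_def coeff_a_def coeff_b_def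
      coeff_d0_def coeff_d1_def algebra_simps del: fps_deriv_nth)
qed

text \<open>To be applied to differences of coefficients: exchanging the boundary function in the
  operator then costs the change of the coefficients times the common bound of \<open>v\<close> and
  \<open>v'\<close>. The factor 3 is 2 from the integral along \<open>r\<close> and 1 from the one
  along \<open>s\<close>.\<close>

lemma abs_goursat_op_le:
  assumes v: "continuous_on Sbar v" "continuous_on Sbar v'"
    and bound: "\<And>z. z \<in> Sbar \<Longrightarrow> \<bar>v z\<bar> \<le> M" "\<And>z. z \<in> Sbar \<Longrightarrow> \<bar>v' z\<bar> \<le> M"
    and xy: "(x, y) \<in> Sbar"
  shows "\<bar>goursat_op a b d0 d1 v v' x y\<bar> \<le> M * (\<bar>a\<bar> + \<bar>d0\<bar> + 2 * \<bar>d1\<bar> + 3 * \<bar>b\<bar>)"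
proof -
  note xy' = SbarD[OF xy]
  have M: "0 \<le> M" using bound(1)[OF xy] by linarith
  have sub: "(s, r) \<in> Sbar" if "s \<in> {y..x}" "r \<in> {0..y}" for s r
    using Sbar_rectangle[OF xy that] .
  have comp: "continuous_on X (\<lambda>u. v (g u))" "continuous_on X (\<lambda>u. v' (g u))"
    if "continuous_on X g" "g ` X \<subseteq> Sbar" for X and g :: "'b::topological_space \<Rightarrow> real \<times> real"
    by (rule continuous_on_compose2[OF v(1) that] continuous_on_compose2[OF v(2) that])+
  have const_bound: "\<bar>integral {p..q} h\<bar> \<le> c * (q - p)"
    if "p \<le> q" "continuous_on {p..q} h" "\<And>r. r \<in> {p..q} \<Longrightarrow> \<bar>h r\<bar> \<le> c" for p q c and h :: "real \<Rightarrow> real"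
    using integral_bound[OF that(1,2), of c] that(3) by simp
  define G where "G r s = a * v' (s, r) + (d0 + (s - r) * d1) * v (s, r)" for r s
  define g where "g = M * (\<bar>a\<bar> + \<bar>d0\<bar> + 2 * \<bar>d1\<bar>)"
  have g: "0 \<le> g" using M by (simp add: g_def)
  have "\<bar>G r s\<bar> \<le> g" if "r \<in> {0..y}" "s \<in> {y..x}" for r s
  proof -
    have z: "(s, r) \<in> Sbar" using sub that by auto
    have "\<bar>a * v' (s, r)\<bar> \<le> \<bar>a\<bar> * M"
      unfolding abs_mult using bound(2)[OF z] by (intro mult_left_mono) auto
    moreover have "\<bar>(d0 + (s - r) * d1) * v (s, r)\<bar> \<le> (\<bar>d0\<bar> + 2 * \<bar>d1\<bar>) * M"
      unfolding abs_mult
    proof (rule mult_mono)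
      have "\<bar>(s - r) * d1\<bar> \<le> 2 * \<bar>d1\<bar>"
        unfolding abs_mult using that xy' by (intro mult_right_mono) auto
      then show "\<bar>d0 + (s - r) * d1\<bar> \<le> \<bar>d0\<bar> + 2 * \<bar>d1\<bar>" by linarith
    qed (use bound(1)[OF z] in auto)
    ultimately show ?thesis unfolding G_def g_def by (simp add: algebra_simps)
  qed
  note G = this
  have cG: "continuous_on ({0..y} \<times> {y..x}) (\<lambda>(r, s). G r s)"
    unfolding G_def case_prod_beta by (intro continuous_intros comp) (use sub in auto)
  have cG1: "continuous_on {y..x} (G r)" if "r \<in> {0..y}" for r
    by (rule continuous_on_compose2[OF cG, of _ "\<lambda>s. (r, s)", simplified])
       (use that in \<open>auto intro!: continuous_intros\<close>)
  have cG2: "continuous_on {0..y} (\<lambda>r. integral {y..x} (G r))"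
    using integral_continuous_on_param[of "{0..y}" y x G] cG by simp
  have "\<bar>integral {0..y} (\<lambda>r. integral {y..x} (G r))\<bar> \<le> (g * (x - y)) * (y - 0)"
    by (intro const_bound cG2 cG1 G) (use xy' in auto)
  also have "\<dots> \<le> g" using mult_left_mono[OF xy'(8) g] by (simp add: mult_ac)
  finally have 1: "\<bar>integral {0..y} (\<lambda>r. integral {y..x} (G r))\<bar> \<le> g" .
  have "\<bar>integral {0..y} (\<lambda>r. x * v (x, r) - y * v (y, r))\<bar> \<le> (2 * M) * (y - 0)"
  proof (rule const_bound)
    show "continuous_on {0..y} (\<lambda>r. x * v (x, r) - y * v (y, r))"
      by (intro continuous_intros comp) (use sub xy' in auto)
    fix r assume r: "r \<in> {0..y}"
    then have "\<bar>x * v (x, r)\<bar> \<le> x * M" "\<bar>y * v (y, r)\<bar> \<le> y * M"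
      unfolding abs_mult using xy' bound(1) sub by (auto intro!: mult_mono)
    moreover have "x * M + y * M \<le> 2 * M"
      using mult_right_mono[OF _ M, of "x + y" 2] xy' by (simp add: algebra_simps)
    ultimately show "\<bar>x * v (x, r) - y * v (y, r)\<bar> \<le> 2 * M" by linarith
  qed (use xy' in auto)
  also have "\<dots> \<le> 2 * M" using xy' M by (intro mult_left_le) auto
  finally have 2: "\<bar>integral {0..y} (\<lambda>r. x * v (x, r) - y * v (y, r))\<bar> \<le> 2 * M" .
  have "\<bar>integral {y..x} (\<lambda>s. v (s, y))\<bar> \<le> M * (x - y)"
  proof (rule const_bound)
    show "continuous_on {y..x} (\<lambda>s. v (s, y))"
      by (intro continuous_intros comp) (use sub xy' in auto)
  qed (use xy' bound sub in auto)
  then have "\<bar>y * integral {y..x} (\<lambda>s. v (s, y))\<bar> \<le> y * (M * (x - y))"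
    unfolding abs_mult using xy' by (intro mult_mono) auto
  also have "\<dots> \<le> M" using mult_left_mono[OF xy'(8) M] by (simp add: mult_ac)
  finally have 3: "\<bar>y * integral {y..x} (\<lambda>s. v (s, y))\<bar> \<le> M" .
  have "\<bar>b * (integral {0..y} (\<lambda>r. x * v (x, r) - y * v (y, r)) + y * integral {y..x} (\<lambda>s. v (s, y)))\<bar> \<le> \<bar>b\<bar> * (3 * M)"
    unfolding abs_mult[of b] using 2 3 by (intro mult_left_mono) linarith+
  then have "\<bar>goursat_op a b d0 d1 v v' x y\<bar> \<le> g + \<bar>b\<bar> * (3 * M)"
    using 1 unfolding goursat_op_def G_def[symmetric] by (intro order_trans[OF abs_triangle_ineq4] add_mono)
  also have "\<dots> = M * (\<bar>a\<bar> + \<bar>d0\<bar> + 2 * \<bar>d1\<bar> + 3 * \<bar>b\<bar>)"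
    by (simp add: g_def algebra_simps)
  finally show ?thesis .
qed

text \<open>Linearity in the coefficients separates the two boundary functions, linearity in the
  pair of functions the two kernels; both are needed because each kernel solves an equation with its
  own coefficients.\<close>

lemma goursat_op_diff:
  assumes u: "continuous_on Sbar u" "continuous_on Sbar u'"
    and v: "continuous_on Sbar v" "continuous_on Sbar v'" and xy: "(x, y) \<in> Sbar"
  shows "goursat_op (a - a') (b - b') (d0 - d0') (d1 - d1') u u' x y
    = goursat_op a b d0 d1 u u' x y - goursat_op a' b' d0' d1' u u' x y"
    and "goursat_op a b d0 d1 (\<lambda>z. u z - v z) (\<lambda>z. u' z - v' z) x y
    = goursat_op a b d0 d1 u u' x y - goursat_op a b d0 d1 v v' x y"
proof -
  note xy' = SbarD[OF xy]
  have sub: "(s, r) \<in> Sbar" if "s \<in> {y..x}" "r \<in> {0..y}" for s r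
    using Sbar_rectangle[OF xy that] .
  have comp: "continuous_on X (\<lambda>w. h (g w))"
    if "h \<in> {u, u', v, v'}" "continuous_on X g" "g ` X \<subseteq> Sbar"
    for h X and g :: "'b::topological_space \<Rightarrow> real \<times> real"
    using that u v continuous_on_compose2[OF _ that(2,3)] by auto
  define J where "J h = integral {0..y} (\<lambda>r. integral {y..x} (\<lambda>s. h r s))" for h :: "real \<Rightarrow> real \<Rightarrow> real"
  have Jdiff: "J (\<lambda>r s. h r s - k r s) = J h - J k"
    if h: "continuous_on ({0..y} \<times> {y..x}) (\<lambda>(r, s). h r s)" and k: "continuous_on ({0..y} \<times> {y..x}) (\<lambda>(r, s). k r s)"
    for h k :: "real \<Rightarrow> real \<Rightarrow> real"
  proof -
    have c1: "continuous_on {y..x} (h r)" "continuous_on {y..x} (k r)" if "r \<in> {0..y}" for r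
      using that by (auto intro!: continuous_intros
          continuous_on_compose2[OF h, of _ "\<lambda>s. (r, s)", simplified]
          continuous_on_compose2[OF k, of _ "\<lambda>s. (r, s)", simplified])
    have c2: "continuous_on {0..y} (\<lambda>r. integral {y..x} (h r))" "continuous_on {0..y} (\<lambda>r. integral {y..x} (k r))"
      using integral_continuous_on_param[of "{0..y}" y x h] integral_continuous_on_param[of "{0..y}" y x k]
        h k by simp_all
    have "J (\<lambda>r s. h r s - k r s) = integral {0..y} (\<lambda>r. integral {y..x} (h r) - integral {y..x} (k r))"
      unfolding J_def by (intro integral_cong integral_diff integrable_continuous_real c1) auto
    also have "\<dots> = J h - J k"
      unfolding J_def by (intro integral_diff integrable_continuous_real c2)
    finally show ?thesis .
  qed
  define F where "F a d0 d1 u u' r s = a * u' (s, r) + (d0 + (s - r) * d1) * u (s, r)"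
    for a d0 d1 :: real and u u' :: "real \<times> real \<Rightarrow> real" and r s
  have cF: "continuous_on ({0..y} \<times> {y..x}) (\<lambda>(r, s). F a d0 d1 h h' r s)"
    if "h \<in> {u, v}" "h' \<in> {u', v'}" for a d0 d1 h h'
    unfolding F_def case_prod_beta by (intro continuous_intros comp) (use that sub in auto)
  have op: "goursat_op a b d0 d1 u u' x y = J (F a d0 d1 u u')
     - b * (integral {0..y} (\<lambda>r. x * u (x, r) - y * u (y, r)) + y * integral {y..x} (\<lambda>s. u (s, y)))"
    for a b d0 d1 u u'
    by (simp add: goursat_op_def J_def F_def)
  have "J (F (a - a') (d0 - d0') (d1 - d1') u u') = J (\<lambda>r s. F a d0 d1 u u' r s - F a' d0' d1' u u' r s)"
    by (simp add: F_def[abs_def] algebra_simps)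
  also have "\<dots> = J (F a d0 d1 u u') - J (F a' d0' d1' u u')"
    by (intro Jdiff cF) auto
  finally show "goursat_op (a - a') (b - b') (d0 - d0') (d1 - d1') u u' x y
    = goursat_op a b d0 d1 u u' x y - goursat_op a' b' d0' d1' u u' x y"
    unfolding op by (simp add: left_diff_distrib)
  have 1: "J (F a d0 d1 (\<lambda>z. u z - v z) (\<lambda>z. u' z - v' z)) = J (F a d0 d1 u u') - J (F a d0 d1 v v')"
  proof -
    have "J (F a d0 d1 (\<lambda>z. u z - v z) (\<lambda>z. u' z - v' z)) = J (\<lambda>r s. F a d0 d1 u u' r s - F a d0 d1 v v' r s)"
      by (simp add: F_def[abs_def] algebra_simps)
    also have "\<dots> = J (F a d0 d1 u u') - J (F a d0 d1 v v')"
      by (intro Jdiff cF) auto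
    finally show ?thesis .
  qed
  have c: "continuous_on {0..y} (\<lambda>r. x * h (x, r) - y * h (y, r))" "continuous_on {y..x} (\<lambda>s. h (s, y))"
    if "h \<in> {u, v}" for h
    by (intro continuous_intros comp; use that sub xy' in auto)+
  have "integral {0..y} (\<lambda>r. x * (u (x, r) - v (x, r)) - y * (u (y, r) - v (y, r)))
      = integral {0..y} (\<lambda>r. (x * u (x, r) - y * u (y, r)) - (x * v (x, r) - y * v (y, r)))"
    by (simp add: algebra_simps)
  also have "\<dots> = integral {0..y} (\<lambda>r. x * u (x, r) - y * u (y, r)) - integral {0..y} (\<lambda>r. x * v (x, r) - y * v (y, r))"
    by (intro integral_diff integrable_continuous_real c) auto
  finally have 2: "integral {0..y} (\<lambda>r. x * (u (x, r) - v (x, r)) - y * (u (y, r) - v (y, r))) = \<dots>" .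
  have 3: "integral {y..x} (\<lambda>s. u (s, y) - v (s, y)) = integral {y..x} (\<lambda>s. u (s, y)) - integral {y..x} (\<lambda>s. v (s, y))"
    by (intro integral_diff integrable_continuous_real c) auto
  show "goursat_op a b d0 d1 (\<lambda>z. u z - v z) (\<lambda>z. u' z - v' z) x y
    = goursat_op a b d0 d1 u u' x y - goursat_op a b d0 d1 v v' x y"
    unfolding op 1 2 3 by (simp add: algebra_simps)
qed

section \<open>Coefficients under small changes of the boundary function\<close>

lemma abs_tderiv_diff_le_C2_dist:
  assumes "t0 < T" "l \<in> Comega t0 T" "m \<in> Comega t0 T" "t \<in> {t0..T}"
  shows "(\<Sum>j\<le>2. \<bar>tderiv t0 T j l t - tderiv t0 T j m t\<bar>) \<le> C2_dist t0 T l m"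
proof -
  have "\<bar>tderiv t0 T j l t - tderiv t0 T j m t\<bar> \<le> (SUP t\<in>{t0..T}. \<bar>tderiv t0 T j l t - tderiv t0 T j m t\<bar>)" for j
  proof (rule cSUP_upper[OF assms(4)])
    show "bdd_above ((\<lambda>t. \<bar>tderiv t0 T j l t - tderiv t0 T j m t\<bar>) ` {t0..T})"
      using assms
      by (intro compact_imp_bounded[THEN bounded_imp_bdd_above] compact_continuous_image
          continuous_intros continuous_on_tderiv) (auto simp: Comega_def)
  qed
  then have "(\<Sum>j\<le>2. \<bar>tderiv t0 T j l t - tderiv t0 T j m t\<bar>)
      \<le> (\<Sum>j\<le>2. SUP t\<in>{t0..T}. \<bar>tderiv t0 T j l t - tderiv t0 T j m t\<bar>)"
    by (intro sum_mono)
  then show ?thesis using assms by (simp add: C2_dist_def)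
qed

text \<open>Mere continuity of \<open>g\<close> suffices: the jets of the one function
  \<open>l\<close> fill a compact set, and jets within distance 1 of it lie in a fixed ball, on
  which \<open>g\<close> is uniformly continuous.\<close>

lemma jet2_uniformly_continuous:
  fixes g :: "real \<times> real \<times> real \<Rightarrow> 'a::metric_space"
  assumes "t0 < T" "l \<in> Comega t0 T" "continuous_on UNIV g" "0 < e"
  obtains \<eta> where "0 < \<eta>" "\<And>m t. m \<in> Comega t0 T \<Longrightarrow> C2_dist t0 T l m < \<eta> \<Longrightarrow> t \<in> {t0..T} \<Longrightarrow>
    dist (g (jet2 t0 T l t)) (g (jet2 t0 T m t)) < e"
proof -
  have l: "real_analytic_Icc t0 T l" using assms(2) by (simp add: Comega_def)
  have "continuous_on {t0..T} (jet2 t0 T l)"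
    using continuous_on_tderiv[OF assms(1) l, of 0] continuous_on_tderiv[OF assms(1) l, of 1]
      continuous_on_tderiv[OF assms(1) l, of 2]
    unfolding jet2_def[abs_def] by (auto intro!: continuous_on_Pair)
  then have "compact (jet2 t0 T l ` {t0..T})"
    by (intro compact_continuous_image) auto
  then obtain B where B: "\<And>t. t \<in> {t0..T} \<Longrightarrow> norm (jet2 t0 T l t) \<le> B"
    using compact_imp_bounded bounded_iff by (metis imageI)
  have "uniformly_continuous_on (cball 0 (B + 1)) g"
    using assms(3) by (intro compact_uniformly_continuous) (auto intro: continuous_on_subset)
  then obtain d where d: "0 < d"
    "\<And>u v. u \<in> cball 0 (B + 1) \<Longrightarrow> v \<in> cball 0 (B + 1) \<Longrightarrow> dist v u < d \<Longrightarrow> dist (g v) (g u) < e"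
    unfolding uniformly_continuous_on_def using assms(4) by meson
  show ?thesis
  proof (rule that[of "min d 1"])
    fix m t assume m: "m \<in> Comega t0 T" "C2_dist t0 T l m < min d 1" and t: "t \<in> {t0..T}"
    have "dist (jet2 t0 T l t) (jet2 t0 T m t) \<le> \<bar>l t - m t\<bar>
        + (\<bar>tderiv t0 T 1 l t - tderiv t0 T 1 m t\<bar> + \<bar>tderiv t0 T 2 l t - tderiv t0 T 2 m t\<bar>)"
      unfolding jet2_def dist_norm diff_Pair
      by (intro order_trans[OF norm_Pair_le] add_mono) auto
    also have "\<dots> = (\<Sum>j\<le>2. \<bar>tderiv t0 T j l t - tderiv t0 T j m t\<bar>)"
      by (simp add: numeral_2_eq_2 del: tderiv.simps(2))
    also have "\<dots> < min d 1"
      using abs_tderiv_diff_le_C2_dist[OF assms(1,2) m(1) t] m(2) by linarith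
    finally have *: "dist (jet2 t0 T l t) (jet2 t0 T m t) < min d 1" .
    moreover have "norm (jet2 t0 T m t) \<le> norm (jet2 t0 T l t) + dist (jet2 t0 T l t) (jet2 t0 T m t)"
      by (metis dist_norm norm_minus_commute norm_triangle_sub add.commute)
    ultimately show "dist (g (jet2 t0 T l t)) (g (jet2 t0 T m t)) < e"
      using B[OF t] by (intro d(2)) auto
  qed (use d in auto)
qed


section \<open>Continuity of the kernel operator\<close>

lemma power_over_fact_tendsto_0: "(\<lambda>n. x ^ n / fact n) \<longlonglongrightarrow> (0 :: real)"
  using summable_LIMSEQ_zero[OF summable_exp[of x]] by (simp add: field_simps)

definition kernel_bounded :: "real \<Rightarrow> real \<Rightarrow> real \<Rightarrow> ((real \<times> real) \<times> real \<Rightarrow> real) \<Rightarrow> bool" where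
  "kernel_bounded t0 T M K \<longleftrightarrow>
     (\<forall>v\<in>Kdom t0 T. \<bar>K v\<bar> \<le> M \<and> \<bar>d_t t0 T K v\<bar> \<le> M)"

text \<open>\<open>SUP\<close> dominates the individual values only if these are bounded above,
  which continuity on the compact triangle provides. The two absolute values at a point then have
  sum at most \<open>M\<close>.\<close>

lemma kernel_boundedI:
  assumes K: "solves_kernel_eq t0 T \<alpha> lam0 c l K"
    and bound: "\<And>t. t \<in> {t0..T} \<Longrightarrow>
      (SUP p\<in>Sbar. \<bar>K (p, t)\<bar>) + (SUP p\<in>Sbar. \<bar>d_t t0 T K (p, t)\<bar>) \<le> M"
  shows "kernel_bounded t0 T M K"
proof -
  have "\<bar>K (z, t)\<bar> \<le> M \<and> \<bar>d_t t0 T K (z, t)\<bar> \<le> M" if z: "z \<in> Sbar" and t: "t \<in> {t0..T}" for z t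
  proof -
    have le: "\<bar>h (z, t)\<bar> \<le> (SUP p\<in>Sbar. \<bar>h (p, t)\<bar>)" if "continuous_on (Kdom t0 T) h" for h :: "_ \<Rightarrow> real"
    proof (rule cSUP_upper[OF z])
      have "continuous_on Sbar (\<lambda>p. \<bar>h (p, t)\<bar>)"
        by (intro continuous_intros continuous_on_compose2[OF that])
           (use t in \<open>auto simp: Kdom_def\<close>)
      then show "bdd_above ((\<lambda>p. \<bar>h (p, t)\<bar>) ` Sbar)"
        by (intro bounded_imp_bdd_above compact_imp_bounded compact_continuous_image compact_Sbar)
    qed
    show ?thesis
      using le[OF kernel_continuous(1)[OF K]] le[OF kernel_continuous(2)[OF K]] bound[OF t] by linarith
  qed
  then show ?thesis by (auto simp: kernel_bounded_def Kdom_def)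
qed

text \<open>The iterated coefficients belong to \<open>l\<close>, while the second function enters
  only through its 2-jet and the bound \<open>M\<close> on its kernel; hence \<open>\<eta>\<close>
  can be fixed before \<open>m\<close> and \<open>H\<close> are known.\<close>

lemma kernel_difference_small:
  assumes "t0 < T" "0 < \<alpha>" "0 < M" "0 < tol"
    and l: "l \<in> Comega t0 T" "factorial_derivative_bound t0 T l" "\<And>t. t \<in> {t0..T} \<Longrightarrow> 0 < l t"
    and K: "solves_kernel_eq t0 T \<alpha> lam0 c l K" "kernel_bounded t0 T M K"
  shows "\<exists>\<eta>>0. \<forall>m\<in>Comega t0 T. \<forall>H. C2_dist t0 T l m < \<eta> \<longrightarrow> (\<forall>t\<in>{t0..T}. 0 < m t) \<longrightarrow>
    solves_kernel_eq t0 T \<alpha> lam0 c m H \<longrightarrow> kernel_bounded t0 T M H \<longrightarrow>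
    (\<forall>v\<in>Kdom t0 T. \<bar>K v - H v\<bar> \<le> tol)"
proof -
  define \<kappa> where "\<kappa> = lam0 + c"
  have l': "real_analytic_Icc t0 T l" using l by (simp add: Comega_def)
  obtain a b d0 d1 where jets:
    "analytic_jet_on {t0<..T} a" "\<And>t. fps_nth (a t) 0 = coeff_a \<alpha> (jet2 t0 T l t)"
    "analytic_jet_on {t0<..T} b" "\<And>t. fps_nth (b t) 0 = coeff_b \<alpha> (jet2 t0 T l t)"
    "analytic_jet_on {t0<..T} d0" "\<And>t. fps_nth (d0 t) 0 = coeff_d0 \<alpha> \<kappa> (jet2 t0 T l t)"
    "analytic_jet_on {t0<..T} d1" "\<And>t. fps_nth (d1 t) 0 = coeff_d1 \<alpha> (jet2 t0 T l t)"
    by (rule coefficient_jets[OF assms(1) l' l(2), of \<alpha> \<kappa>]) (rule that)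
  have "\<exists>A>0. \<exists>\<rho>>0. \<forall>B \<sigma> t j. A \<le> B \<longrightarrow> \<rho> \<le> \<sigma> \<longrightarrow> t \<in> {t0<..T} \<longrightarrow> \<bar>fps_nth (u t) j\<bar> \<le> B * \<sigma> ^ j"
    if "analytic_jet_on {t0<..T} u" for u
  proof -
    have "geometrically_bounded_on {t0<..T} u" using that by (simp add: analytic_jet_on_def)
    then show ?thesis by (rule geometrically_bounded_onE) blast
  qed
  note gb = this
  obtain A1 r1 where 1: "0 < A1" "0 < r1" "\<And>B \<sigma> t j. A1 \<le> B \<Longrightarrow> r1 \<le> \<sigma> \<Longrightarrow> t \<in> {t0<..T} \<Longrightarrow> \<bar>fps_nth (a t) j\<bar> \<le> B * \<sigma> ^ j"
    using gb[OF jets(1)] by blast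
  obtain A2 r2 where 2: "0 < A2" "0 < r2" "\<And>B \<sigma> t j. A2 \<le> B \<Longrightarrow> r2 \<le> \<sigma> \<Longrightarrow> t \<in> {t0<..T} \<Longrightarrow> \<bar>fps_nth (b t) j\<bar> \<le> B * \<sigma> ^ j"
    using gb[OF jets(3)] by blast
  obtain A3 r3 where 3: "0 < A3" "0 < r3" "\<And>B \<sigma> t j. A3 \<le> B \<Longrightarrow> r3 \<le> \<sigma> \<Longrightarrow> t \<in> {t0<..T} \<Longrightarrow> \<bar>fps_nth (d0 t) j\<bar> \<le> B * \<sigma> ^ j"
    using gb[OF jets(5)] by blast
  obtain A4 r4 where 4: "0 < A4" "0 < r4" "\<And>B \<sigma> t j. A4 \<le> B \<Longrightarrow> r4 \<le> \<sigma> \<Longrightarrow> t \<in> {t0<..T} \<Longrightarrow> \<bar>fps_nth (d1 t) j\<bar> \<le> B * \<sigma> ^ j"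
    using gb[OF jets(7)] by blast
  define A where "A = A1 + A2 + A3 + A4"
  \<comment> \<open>A third of the interval leaves room for a window of half-width
    \<open>\<epsilon>\<close> that avoids \<open>t0\<close>. Shifts in time will cost
    \<open>2 * M * \<epsilon>\<close> and \<open>4 * M * \<epsilon>\<close>, together at most a
    quarter of \<open>tol\<close>.\<close>
  define \<epsilon> where "\<epsilon> = min ((T - t0) / 3) (tol / (24 * M))"
  have \<epsilon>: "0 < \<epsilon>" "3 * \<epsilon> \<le> T - t0" "24 * M * \<epsilon> \<le> tol"
  proof -
    show "0 < \<epsilon>" using assms(1-4) by (simp add: \<epsilon>_def)
    have "\<epsilon> \<le> (T - t0) / 3" by (simp only: \<epsilon>_def min.cobounded1)
    then show "3 * \<epsilon> \<le> T - t0" by (simp add: field_simps)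
    have "\<epsilon> \<le> tol / (24 * M)" by (simp add: \<epsilon>_def)
    then show "24 * M * \<epsilon> \<le> tol" using assms(3) by (simp add: field_simps)
  qed
  \<comment> \<open>The doubled sum gives the ratio \<open>R / 2\<close> for all four coefficients;
    the summand \<open>1 / \<epsilon>\<close> admits the test functions.\<close>
  define R where "R = 2 * (r1 + r2 + r3 + r4) + 1 / \<epsilon>"
  have A: "A1 \<le> A" "A2 \<le> A" "A3 \<le> A" "A4 \<le> A" "0 < A" using 1 2 3 4 by (auto simp: A_def)
  have R_ge: "r1 \<le> R / 2" "r2 \<le> R / 2" "r3 \<le> R / 2" "r4 \<le> R / 2" "0 < R" "1 / \<epsilon> \<le> R"
    using 1(2) 2(2) 3(2) 4(2) \<epsilon>(1) by (auto simp: R_def add_pos_pos)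
  \<comment> \<open>The bases of the two powers in \<open>abs_midpoint_le\<close> are merged. That
    lemma will be used with \<open>2 * M\<close> as the bound of \<open>w\<close>, hence the factor
    \<open>4 * M\<close>.\<close>
  define X where "X = 16 / 3 * (2 * A * (R + 6))"
  have "(\<lambda>N. 4 * M * (X ^ N / fact N)) \<longlonglongrightarrow> 4 * M * 0"
    by (intro tendsto_intros power_over_fact_tendsto_0)
  then have "\<forall>\<^sub>F N in sequentially. 4 * M * (X ^ N / fact N) < tol / 4"
    by (rule order_tendstoD) (use assms in auto)
  then obtain N where N: "4 * M * (X ^ N / fact N) < tol / 4"
    by (auto simp: eventually_sequentially)
  define Q where "Q = (16 / 3) ^ N * defect_const (2 * \<epsilon>) A R N 0 / \<epsilon>"
  have Q: "0 \<le> Q" using defect_const_nonneg[of "2 * \<epsilon>" A R N 0] A R_ge(5) \<epsilon> by (simp add: Q_def)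
  \<comment> \<open>Changing the coefficients of the operator costs at most
    \<open>7 * M * \<delta>'\<close>, where 7 = 1 + 1 + 2 + 3, and each of the two boundary values
    at most \<open>6 * \<delta>'\<close>. Adding 1 to \<open>Q\<close> keeps the divisor
    positive.\<close>
  define \<delta>' where "\<delta>' = tol / (4 * (Q + 1) * (7 * M + 12))"
  have \<delta>': "0 < \<delta>'" using assms Q by (simp add: \<delta>'_def)
  define \<delta> where "\<delta> = (7 * M + 12) * \<delta>'"
  have Q\<delta>: "Q * \<delta> \<le> tol / 4"
  proof -
    have "\<delta> = tol / (4 * (Q + 1))" using assms(3) by (simp add: \<delta>_def \<delta>'_def)
    then have "(Q + 1) * \<delta> = tol / 4" using Q by (simp add: field_simps)
    moreover have "0 \<le> \<delta>" using assms(3) \<delta>' by (simp add: \<delta>_def)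
    ultimately show ?thesis by (simp add: distrib_right)
  qed
  \<comment> \<open>All six coefficients are combined into one function, so that a single
    \<open>\<eta>\<close> serves them.\<close>
  define g where "g u = ((coeff_a \<alpha> u, coeff_b \<alpha> u), (coeff_d0 \<alpha> \<kappa> u, coeff_d1 \<alpha> u), (coeff_f1 \<alpha> \<kappa> u, coeff_f2 \<alpha> u))" for u
  have "continuous_on UNIV g"
    unfolding g_def[abs_def] coeff_a_def coeff_b_def coeff_d0_def coeff_d1_def coeff_f1_def coeff_f2_def case_prod_beta
    by (intro continuous_intros) (use assms(2) in auto)
  from jet2_uniformly_continuous[OF assms(1) l(1) this \<delta>'] obtain \<eta> where \<eta>: "0 < \<eta>"
    "\<And>m t. m \<in> Comega t0 T \<Longrightarrow> C2_dist t0 T l m < \<eta> \<Longrightarrow> t \<in> {t0..T} \<Longrightarrow>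
      dist (g (jet2 t0 T l t)) (g (jet2 t0 T m t)) < \<delta>'" by blast
  show ?thesis
  proof (intro exI[of _ \<eta>] conjI ballI allI impI)
    fix m H v
    assume m: "m \<in> Comega t0 T" "\<forall>t\<in>{t0..T}. 0 < m t" "C2_dist t0 T l m < \<eta>"
      and H: "solves_kernel_eq t0 T \<alpha> lam0 c m H" "kernel_bounded t0 T M H" and v: "v \<in> Kdom t0 T"
    define w where "w = (\<lambda>v. K v - H v)"
    define w' where "w' = (\<lambda>v. d_t t0 T K v - d_t t0 T H v)"
    have w_cont: "continuous_on (Kdom t0 T) w" "continuous_on (Kdom t0 T) w'"
      unfolding w_def w'_def by (intro continuous_on_diff kernel_continuous[OF K(1)] kernel_continuous[OF H(1)])+
    have w_deriv: "((\<lambda>t. w (z, t)) has_real_derivative w' (z, t)) (at t within S)"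
      if "z \<in> Sbar" "S \<subseteq> {t0..T}" "t \<in> S" for z t S
      unfolding w_def w'_def
      by (intro DERIV_diff kernel_has_time_derivative[OF K(1)] kernel_has_time_derivative[OF H(1)] that)
    have w_bound: "\<bar>w (z, t)\<bar> \<le> 2 * M" "\<bar>w' (z, t)\<bar> \<le> 2 * M" if "z \<in> Sbar" "t \<in> {t0..T}" for z t
    proof -
      have "(z, t) \<in> Kdom t0 T" using that by (simp add: Kdom_def)
      then have "\<bar>K (z, t)\<bar> \<le> M" "\<bar>d_t t0 T K (z, t)\<bar> \<le> M" "\<bar>H (z, t)\<bar> \<le> M" "\<bar>d_t t0 T H (z, t)\<bar> \<le> M"
        using K(2) H(2) unfolding kernel_bounded_def by blast+
      then show "\<bar>w (z, t)\<bar> \<le> 2 * M" "\<bar>w' (z, t)\<bar> \<le> 2 * M" unfolding w_def w'_def by linarith+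
    qed
    have lip: "\<bar>w (z, s) - w (z, t)\<bar> \<le> 2 * M * \<bar>s - t\<bar>" if "z \<in> Sbar" "s \<in> {t0..T}" "t \<in> {t0..T}" for z s t
      using field_differentiable_bound[of "{t0..T}" "\<lambda>t. w (z, t)" "\<lambda>t. w' (z, t)" "2 * M" s t]
        w_deriv w_bound that by auto
    have defect: "\<bar>w ((x, y), t) - goursat_op (fps_nth (a t) 0) (fps_nth (b t) 0) (fps_nth (d0 t) 0)
         (fps_nth (d1 t) 0) (\<lambda>z. w (z, t)) (\<lambda>z. w' (z, t)) x y\<bar> \<le> \<delta>"
      if xy: "(x, y) \<in> Sbar" and t: "t \<in> {t0..T}" for x y t
    proof -
      define P where "P = jet2 t0 T l t"
      define P' where "P' = jet2 t0 T m t"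
      have dP: "dist (g P) (g P') < \<delta>'" unfolding P_def P'_def by (rule \<eta>(2)[OF m(1,3) t])
      have coeffs: "\<bar>coeff_a \<alpha> P - coeff_a \<alpha> P'\<bar> \<le> \<delta>'" "\<bar>coeff_b \<alpha> P - coeff_b \<alpha> P'\<bar> \<le> \<delta>'"
        "\<bar>coeff_d0 \<alpha> \<kappa> P - coeff_d0 \<alpha> \<kappa> P'\<bar> \<le> \<delta>'" "\<bar>coeff_d1 \<alpha> P - coeff_d1 \<alpha> P'\<bar> \<le> \<delta>'"
        "\<bar>coeff_f1 \<alpha> \<kappa> P - coeff_f1 \<alpha> \<kappa> P'\<bar> \<le> \<delta>'" "\<bar>coeff_f2 \<alpha> P - coeff_f2 \<alpha> P'\<bar> \<le> \<delta>'"
      proof -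
        have p: "dist (fst u) (fst u') < \<delta>'" "dist (snd u) (snd u') < \<delta>'" if "dist u u' < \<delta>'"
          for u u' :: "'c::metric_space \<times> 'd::metric_space"
          using that dist_fst_le dist_snd_le by (meson le_less_trans)+
        note q = p(1)[OF p(1)[OF dP]] p(2)[OF p(1)[OF dP]] p(1)[OF p(1)[OF p(2)[OF dP]]]
          p(2)[OF p(1)[OF p(2)[OF dP]]] p(1)[OF p(2)[OF p(2)[OF dP]]] p(2)[OF p(2)[OF p(2)[OF dP]]]
        show "\<bar>coeff_a \<alpha> P - coeff_a \<alpha> P'\<bar> \<le> \<delta>'" "\<bar>coeff_b \<alpha> P - coeff_b \<alpha> P'\<bar> \<le> \<delta>'"
          "\<bar>coeff_d0 \<alpha> \<kappa> P - coeff_d0 \<alpha> \<kappa> P'\<bar> \<le> \<delta>'" "\<bar>coeff_d1 \<alpha> P - coeff_d1 \<alpha> P'\<bar> \<le> \<delta>'"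
          "\<bar>coeff_f1 \<alpha> \<kappa> P - coeff_f1 \<alpha> \<kappa> P'\<bar> \<le> \<delta>'" "\<bar>coeff_f2 \<alpha> P - coeff_f2 \<alpha> P'\<bar> \<le> \<delta>'"
          using q by (simp_all add: g_def dist_real_def)
      qed
      have slice: "continuous_on Sbar (\<lambda>z. h (z, t))" if "continuous_on (Kdom t0 T) h" for h :: "_ \<Rightarrow> real"
        by (rule continuous_on_compose2[OF that])
           (use t in \<open>auto simp: Kdom_def intro!: continuous_intros\<close>)
      note cK = slice[OF kernel_continuous(1)[OF K(1)]] slice[OF kernel_continuous(2)[OF K(1)]]
      note cH = slice[OF kernel_continuous(1)[OF H(1)]] slice[OF kernel_continuous(2)[OF H(1)]]
      have bH: "\<bar>H (z, t)\<bar> \<le> M" "\<bar>d_t t0 T H (z, t)\<bar> \<le> M" if "z \<in> Sbar" for z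
        using H(2) that t unfolding kernel_bounded_def Kdom_def by blast+
      define f where "f \<xi> = f_bdry t0 T \<alpha> lam0 c l \<xi> t - f_bdry t0 T \<alpha> lam0 c m \<xi> t" for \<xi>
      have f: "\<bar>f \<xi>\<bar> \<le> 6 * \<delta>'" if "0 \<le> \<xi>" "\<xi> \<le> 2" for \<xi>
      proof -
        have "f \<xi> = \<xi> * (coeff_f1 \<alpha> \<kappa> P - coeff_f1 \<alpha> \<kappa> P') + \<xi>\<^sup>2 * (coeff_f2 \<alpha> P - coeff_f2 \<alpha> P')"
          unfolding f_def f_bdry_eq \<kappa>_def P_def P'_def by (simp add: algebra_simps)
        moreover have "\<bar>\<xi> * (coeff_f1 \<alpha> \<kappa> P - coeff_f1 \<alpha> \<kappa> P')\<bar> \<le> 2 * \<delta>'"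
          unfolding abs_mult using that coeffs by (intro mult_mono) auto
        moreover have "\<xi>\<^sup>2 \<le> 2\<^sup>2" using that by (intro power_mono) auto
        then have "\<bar>\<xi>\<^sup>2 * (coeff_f2 \<alpha> P - coeff_f2 \<alpha> P')\<bar> \<le> 4 * \<delta>'"
          unfolding abs_mult using coeffs by (intro mult_mono) auto
        ultimately show ?thesis by linarith
      qed
      define op where "op p = goursat_op (coeff_a \<alpha> p) (coeff_b \<alpha> p) (coeff_d0 \<alpha> \<kappa> p) (coeff_d1 \<alpha> p)" for p
      define D where "D = goursat_op (coeff_a \<alpha> P - coeff_a \<alpha> P') (coeff_b \<alpha> P - coeff_b \<alpha> P')
        (coeff_d0 \<alpha> \<kappa> P - coeff_d0 \<alpha> \<kappa> P') (coeff_d1 \<alpha> P - coeff_d1 \<alpha> P')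
        (\<lambda>z. H (z, t)) (\<lambda>z. d_t t0 T H (z, t)) x y"
      have "K ((x, y), t) = f_bdry t0 T \<alpha> lam0 c l x t - f_bdry t0 T \<alpha> lam0 c l y t
          + op P (\<lambda>z. K (z, t)) (\<lambda>z. d_t t0 T K (z, t)) x y"
        unfolding op_def P_def \<kappa>_def by (rule kernel_integral_identity[OF K(1) assms(2) l(3)[OF t] t xy])
      moreover have "H ((x, y), t) = f_bdry t0 T \<alpha> lam0 c m x t - f_bdry t0 T \<alpha> lam0 c m y t
          + op P' (\<lambda>z. H (z, t)) (\<lambda>z. d_t t0 T H (z, t)) x y"
        unfolding op_def P'_def \<kappa>_def by (rule kernel_integral_identity[OF H(1) assms(2) bspec[OF m(2) t] t xy])
      moreover have "op P (\<lambda>z. w (z, t)) (\<lambda>z. w' (z, t)) x y =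
          op P (\<lambda>z. K (z, t)) (\<lambda>z. d_t t0 T K (z, t)) x y - op P (\<lambda>z. H (z, t)) (\<lambda>z. d_t t0 T H (z, t)) x y"
        unfolding w_def w'_def op_def by (rule goursat_op_diff(2)[OF cK cH xy])
      moreover have "D = op P (\<lambda>z. H (z, t)) (\<lambda>z. d_t t0 T H (z, t)) x y
          - op P' (\<lambda>z. H (z, t)) (\<lambda>z. d_t t0 T H (z, t)) x y"
        unfolding D_def op_def by (rule goursat_op_diff(1)[OF cH cH xy])
      \<comment> \<open>The operator of \<open>l\<close> is applied to both kernels; that
        \<open>H\<close> solves the equation with the coefficients of \<open>m\<close> is charged to
        \<open>D\<close>.\<close>
      ultimately have w: "w ((x, y), t) - op P (\<lambda>z. w (z, t)) (\<lambda>z. w' (z, t)) x y = f x - f y + D"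
        unfolding w_def f_def by simp
      have "\<bar>D\<bar> \<le> M * (\<bar>coeff_a \<alpha> P - coeff_a \<alpha> P'\<bar> + \<bar>coeff_d0 \<alpha> \<kappa> P - coeff_d0 \<alpha> \<kappa> P'\<bar>
          + 2 * \<bar>coeff_d1 \<alpha> P - coeff_d1 \<alpha> P'\<bar> + 3 * \<bar>coeff_b \<alpha> P - coeff_b \<alpha> P'\<bar>)"
        unfolding D_def by (rule abs_goursat_op_le[OF cH bH xy])
      also have "\<dots> \<le> M * (\<delta>' + \<delta>' + 2 * \<delta>' + 3 * \<delta>')"
        using assms(3) coeffs by (intro mult_left_mono add_mono) auto
      finally have "\<bar>D\<bar> \<le> 7 * M * \<delta>'" by (simp add: algebra_simps)
      moreover have "\<bar>f x\<bar> \<le> 6 * \<delta>'" "\<bar>f y\<bar> \<le> 6 * \<delta>'"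
        using f SbarD[OF xy] by auto
      ultimately have "\<bar>f x - f y + D\<bar> \<le> \<delta>"
        unfolding \<delta>_def distrib_right by linarith
      then show ?thesis
        unfolding jets P_def[symmetric] op_def[symmetric] w .
    qed
    obtain x y t where v_eq: "v = ((x, y), t)" by (metis surj_pair)
    have xy: "(x, y) \<in> Sbar" and t: "t \<in> {t0..T}" using v by (auto simp: v_eq Kdom_def)
    \<comment> \<open>The centre is kept between \<open>t0 + 2 * \<epsilon>\<close> and
      \<open>T - \<epsilon>\<close>, so the window lies in \<open>{t0<..T}\<close>, where the
      coefficient bounds hold. This moves \<open>t\<close> by at most
      \<open>2 * \<epsilon>\<close>.\<close>
    define t1 where "t1 = max (t0 + 2 * \<epsilon>) (min t (T - \<epsilon>))"
    define p where "p = t1 - \<epsilon>"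
    define q where "q = t1 + \<epsilon>"
    have t1: "\<bar>t - t1\<bar> \<le> 2 * \<epsilon>" "t1 \<in> {t0..T}" "{p..q} \<subseteq> {t0<..T}"
      using \<epsilon> t by (auto simp: t1_def p_def q_def)
    then have sub: "{p..q} \<subseteq> {t0..T}" by auto
    have bnd: "\<And>s j. s \<in> {p..q} \<Longrightarrow> \<bar>fps_nth (a s) j\<bar> \<le> A * (R / 2) ^ j"
      "\<And>s j. s \<in> {p..q} \<Longrightarrow> \<bar>fps_nth (b s) j\<bar> \<le> A * (R / 2) ^ j"
      "\<And>s j. s \<in> {p..q} \<Longrightarrow> \<bar>fps_nth (d0 s) j\<bar> \<le> A * (R / 2) ^ j"
      "\<And>s j. s \<in> {p..q} \<Longrightarrow> \<bar>fps_nth (d1 s) j\<bar> \<le> A * (R / 2) ^ j"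
      using 1(3)[OF A(1) R_ge(1)] 2(3)[OF A(2) R_ge(2)] 3(3)[OF A(3) R_ge(3)] 4(3)[OF A(4) R_ge(4)] t1(3) by blast+
    interpret approximate_goursat p q A R "2 * M" \<delta> w w' a b d0 d1
    proof
      show "p \<le> q" "0 \<le> A" "0 < R" using \<epsilon> A R_ge(5) by (auto simp: p_def q_def)
      show "continuous_on (Sbar \<times> {p..q}) w" "continuous_on (Sbar \<times> {p..q}) w'"
        using w_cont sub by (auto simp: Kdom_def intro: continuous_on_subset)
      show "taylor_jet_on {p..q} a" "taylor_jet_on {p..q} b" "taylor_jet_on {p..q} d0" "taylor_jet_on {p..q} d1"
        using jets t1(3) taylor_jet_on_subset unfolding analytic_jet_on_def by blast+
      show "((\<lambda>t. w (z, t)) has_real_derivative w' (z, t)) (at t within {p..q})"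
        if "z \<in> Sbar" "t \<in> {p..q}" for z t
        by (rule w_deriv[OF that(1) sub that(2)])
      show "\<bar>w (z, t)\<bar> \<le> 2 * M" if "z \<in> Sbar" "t \<in> {p..q}" for z t
        by (rule w_bound(1)[OF that(1) subsetD[OF sub that(2)]])
    qed (rule bnd, assumption | rule defect, assumption, rule subsetD[OF sub], assumption)+
    have "\<bar>w ((x, y), s) - w ((x, y), t1)\<bar> \<le> 2 * M * \<epsilon>" if "s \<in> {p..q}" for s
    proof -
      have "\<bar>w ((x, y), s) - w ((x, y), t1)\<bar> \<le> 2 * M * \<bar>s - t1\<bar>"
        using lip[OF xy _ t1(2)] that sub by blast
      also have "\<dots> \<le> 2 * M * \<epsilon>"
        using that assms(3) by (intro mult_left_mono) (auto simp: p_def q_def)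
      finally show ?thesis .
    qed
    from abs_midpoint_le[OF \<epsilon>(1) p_def q_def R_ge(6) xy this, of N]
    have "\<bar>w ((x, y), t1)\<bar> \<le> 2 * M * \<epsilon> + (16 / 3) ^ N *
      (defect_const (2 * \<epsilon>) A R N 0 * \<delta> / \<epsilon> + 2 * (2 * M) * (2 * A * (R + 6)) ^ N / fact N)" .
    also have "\<dots> = 2 * M * \<epsilon> + (Q * \<delta> + 4 * M * (X ^ N / fact N))"
    proof -
      have "k * (d * \<delta> / \<epsilon> + 2 * (2 * M) * z / f) = k * d / \<epsilon> * \<delta> + 4 * M * (k * z / f)" for k d z f :: real
        by (simp add: algebra_simps)
      moreover have "X ^ N = (16 / 3) ^ N * (2 * A * (R + 6)) ^ N"
        unfolding X_def by (rule power_mult_distrib)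
      ultimately show ?thesis by (simp only: Q_def)
    qed
    finally have "\<bar>w ((x, y), t1)\<bar> \<le> 2 * M * \<epsilon> + (tol / 4 + tol / 4)"
      using Q\<delta> N by linarith
    moreover have "\<bar>w ((x, y), t) - w ((x, y), t1)\<bar> \<le> 2 * M * (2 * \<epsilon>)"
      using lip[OF xy t t1(2)] mult_left_mono[OF t1(1), of "2 * M"] assms(3) by linarith
    ultimately have "\<bar>w ((x, y), t)\<bar> \<le> tol" using \<epsilon>(3) assms(3,4) by linarith
    then show "\<bar>K v - H v\<bar> \<le> tol" by (simp add: w_def v_eq)
  qed (rule \<eta>(1))
qed

theorem lemma3p1:
  fixes t0 T \<alpha> lam0 c M :: real and U :: "(real \<Rightarrow> real) set"
  assumes "0 \<le> t0" and "t0 < T" and "0 < \<alpha>" and "0 < lam0"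
    and U_compact: "compactin (mtopology_of (Comega_metric t0 T)) U"
    and U_pos: "\<And>l t. l \<in> U \<Longrightarrow> t \<in> {t0..T} \<Longrightarrow> 0 < l t"
    and U_bound: "\<And>l. l \<in> U \<Longrightarrow> factorial_derivative_bound t0 T l"
    and kernel_unique: "\<And>l. l \<in> U \<Longrightarrow> \<exists>!K. solves_kernel_eq t0 T \<alpha> lam0 c l K"
    and "0 < M"
    and kernel_bound: "\<And>l t. l \<in> U \<Longrightarrow> t \<in> {t0..T} \<Longrightarrow>
      (SUP p\<in>Sbar. \<bar>kernel_op t0 T \<alpha> lam0 c l (p, t)\<bar>)
      + (SUP p\<in>Sbar. \<bar>d_t t0 T (kernel_op t0 T \<alpha> lam0 c l) (p, t)\<bar>) \<le> M"
  shows "kernel_op t0 T \<alpha> lam0 c \<in> U \<rightarrow> XK t0 T \<and>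
    continuous_map (mtopology_of (submetric (Comega_metric t0 T) U))
      (mtopology_of (CK_metric t0 T)) (kernel_op t0 T \<alpha> lam0 c)"
proof -
  define \<K> where "\<K> = kernel_op t0 T \<alpha> lam0 c"
  have U: "U \<subseteq> Comega t0 T"
    using compactin_subset_topspace[OF U_compact] assms(2) by simp
  have sol: "solves_kernel_eq t0 T \<alpha> lam0 c l (\<K> l)" if "l \<in> U" for l
    unfolding \<K>_def kernel_op_def by (rule theI'[OF kernel_unique[OF that]])
  have bound: "kernel_bounded t0 T M (\<K> l)" if "l \<in> U" for l
    using kernel_boundedI[OF sol[OF that]] kernel_bound[OF that] unfolding \<K>_def by blast
  have CK: "\<K> l \<in> mspace (CK_metric t0 T)" if "l \<in> U" for l
  proof -
    have "bounded (\<K> l ` Kdom t0 T)"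
      using bound[OF that] unfolding kernel_bounded_def bounded_iff by auto
    moreover have "continuous_on (Kdom t0 T) (\<K> l)" by (rule kernel_continuous(1)[OF sol[OF that]])
    moreover have "\<K> l \<in> extensional (Kdom t0 T)"
      using sol[OF that] by (simp add: solves_kernel_eq_def)
    ultimately show ?thesis by (simp add: CK_metric_def)
  qed
  have "\<K> \<in> U \<rightarrow> XK t0 T"
    using CK sol by (auto simp: XK_def solves_kernel_eq_def)
  moreover have "continuous_map (mtopology_of (submetric (Comega_metric t0 T) U))
      (mtopology_of (CK_metric t0 T)) \<K>"
    unfolding mtopology_of_def
    unfolding Metric_space.metric_continuous_map[OF Metric_space_mspace_mdist Metric_space_mspace_mdist]
  proof (intro conjI ballI allI impI)
    have ms: "mspace (submetric (Comega_metric t0 T) U) = U" using U assms(2) by auto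
    show "\<K> ` mspace (submetric (Comega_metric t0 T) U) \<subseteq> mspace (CK_metric t0 T)"
      using CK ms by auto
    fix l and e :: real assume l: "l \<in> mspace (submetric (Comega_metric t0 T) U)" and e: "0 < e"
    then have lU: "l \<in> U" using ms by simp
    \<comment> \<open>\<open>M\<close> bounds the kernels of all members of \<open>U\<close>, so the
      \<open>\<eta>\<close> found for \<open>l\<close> serves all its neighbours in
      \<open>U\<close>.\<close>
    obtain \<eta> where \<eta>: "0 < \<eta>"
      "\<forall>m\<in>Comega t0 T. \<forall>H. C2_dist t0 T l m < \<eta> \<longrightarrow> (\<forall>t\<in>{t0..T}. 0 < m t) \<longrightarrow>
        solves_kernel_eq t0 T \<alpha> lam0 c m H \<longrightarrow> kernel_bounded t0 T M H \<longrightarrow>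
        (\<forall>v\<in>Kdom t0 T. \<bar>\<K> l v - H v\<bar> \<le> e / 2)"
      using kernel_difference_small[OF assms(2,3) \<open>0 < M\<close> half_gt_zero[OF e] subsetD[OF U lU]
          U_bound[OF lU] U_pos[OF lU] sol[OF lU] bound[OF lU]] by blast
    show "\<exists>\<delta>>0. \<forall>m. m \<in> mspace (submetric (Comega_metric t0 T) U) \<and>
        mdist (submetric (Comega_metric t0 T) U) l m < \<delta> \<longrightarrow> mdist (CK_metric t0 T) (\<K> l) (\<K> m) < e"
    proof (intro exI conjI allI impI)
      fix m assume "m \<in> mspace (submetric (Comega_metric t0 T) U) \<and>
        mdist (submetric (Comega_metric t0 T) U) l m < \<eta>"
      then have m: "m \<in> U" "C2_dist t0 T l m < \<eta>" using ms assms(2) by auto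
      \<comment> \<open>Pointwise bounds yield only a weak inequality for the supremum; halving
        \<open>e\<close> restores strictness.\<close>
      have "mdist (CK_metric t0 T) (\<K> l) (\<K> m) \<le> e / 2"
        unfolding CK_metric_def
      proof (rule mdist_cfunspace_le)
        fix v assume "v \<in> topspace (top_of_set (Kdom t0 T))"
        then have "v \<in> Kdom t0 T" by simp
        then have "\<bar>\<K> l v - \<K> m v\<bar> \<le> e / 2"
          using \<eta>(2) m U U_pos sol bound by blast
        then show "mdist euclidean_metric (\<K> l v) (\<K> m v) \<le> e / 2" by (simp add: dist_real_def)
      qed (use e in auto)
      then show "mdist (CK_metric t0 T) (\<K> l) (\<K> m) < e" using e by linarith
    qed (rule \<eta>(1))
  qed
  ultimately show ?thesis by (simp add: \<K>_def)
qed

end
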